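(* (a) There exists an absolute constant $c$ such that for every martingale $F\in H_{1/2}(G)$ and every $n\in\mathbb{N}_+$, $$\left\Vert \sigma_n F\right\Vert_{H_{1/2}}\leq c\,V^2(n)\left\Vert F\right\Vert_{H_{1/2}}.$$ (b) Let $\{n_k:k\geq 0\}$ be a subsequence (strictly increasing sequence) of the positive integers $\mathbb{N}_+$ such that $\sup_k V(n_k)=\infty$, and let $\Phi:\mathbb{N}_+\rightarrow[1,\infty)$ be any nondecreasing function satisfying $\Phi(n)\uparrow\infty$ as $n\to\infty$ and $$\limsup_{k\rightarrow\infty}\frac{V^2(n_k)}{\Phi(n_k)}=\infty.$$ Then there exists a martingale $F\in H_{1/2}(G)$ such that $$\sup_{k\in\mathbb{N}}\left\Vert \frac{\sigma_{n_k}F}{\Phi(n_k)}\right\Vert_{1/2}=\infty.$$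
   Context: $\mathbb{N}_+$ is the set of positive integers and $\mathbb{N}=\mathbb{N}_+\cup\{0\}$. $G=\prod_{j\in\mathbb{N}}Z_2$ is the Walsh (dyadic) group: the complete direct product of countably many copies of $Z_2=\{0,1\}$ (addition mod 2, discrete topology), with product topology and normalized Haar measure $\mu$. Elements are $x=(x_0,x_1,\dots)$ with $x_j\in\{0,1\}$. Put $I_0(x)=G$ and $I_n(x)=\{y\in G: y_0=x_0,\dots,y_{n-1}=x_{n-1}\}$. For $n\in\mathbb{N}$ write $n=\sum_{j\ge 0}n_j2^j$ with $n_j\in\{0,1\}$. (For a sequence of integers $\{n_k\}$, $n_k$ denotes the $k$-th term.) The variation of $n$ is $V(n)=n_0+\sum_{k=1}^\infty|n_k-n_{k-1}|$, where $n_k$ here denotes the binary digits of $n$. Rademacher functions: $r_k(x)=(-1)^{x_k}$. Walsh functions: $w_n(x)=\prod_{k\ge0}r_k(x)^{n_k}$. Let $\zeta_n$ be the $\sigma$-algebra generated by the sets $I_n(x)$, $x\in G$. A martingale $F=(F_n,n\in\mathbb{N})$ is always with respect to $(\zeta_n)$; its maximal function is $F^*=\sup_n|F_n|$. For $0<p<\infty$, $\|f\|_p=\left(\int_G|f|^pd\mu\right)^{1/p}$, and $H_p(G)$ is the space of martingales with $\|F\|_{H_p}:=\|F^*\|_p<\infty$. An integrable function $f$ is identified with the martingale of its conditional expectations, so that $\|f\|_{H_p}=\|f^*\|_p$ with $f^*(x)=\sup_{n}\frac{1}{\mu(I_n(x))}\left|\int_{I_n(x)}f\,d\mu\right|$.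 The Walsh–Fourier coefficients of a martingale $F$ are $\widehat F(k)=\lim_{n\to\infty}\int_G F_nw_k\,d\mu$. Partial sums: $S_nF=\sum_{k=0}^{n-1}\widehat F(k)w_k$; Fejér means: $\sigma_nF=\frac1n\sum_{k=1}^nS_kF$ ($n\in\mathbb{N}_+$). These are Walsh polynomials, i.e. functions on $G$. *)

theory Defs
  imports "HOL-Probability.Probability" "HOL-Library.Z2"
begin

text \<open>
  Functions on the Walsh group take values in a scalar type of class
  \<^class>\<open>real_normed_field\<close>, \<^class>\<open>banach\<close>, \<^class>\<open>second_countable_topology\<close>;
  this covers both the real and the complex numbers.
\<close>

type_synonym walsh_group = "nat \<Rightarrow> bit"

definition haar :: "walsh_group measure"
  where "haar = Pi\<^sub>M UNIV (\<lambda>_. uniform_count_measure UNIV)"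

definition cyl :: "nat \<Rightarrow> walsh_group \<Rightarrow> walsh_group set"
  where "cyl n x = {y. \<forall>j<n. y j = x j}"

definition digit :: "nat \<Rightarrow> nat \<Rightarrow> nat"
  where "digit n j = (n div 2 ^ j) mod 2"

definition variation :: "nat \<Rightarrow> real"
  where "variation n = real (digit n 0) + (\<Sum>k. \<bar>real (digit n (Suc k)) - real (digit n k)\<bar>)"

definition rademacher :: "nat \<Rightarrow> walsh_group \<Rightarrow> real"
  where "rademacher k x = (if x k = 0 then 1 else - 1)"

definition walsh :: "nat \<Rightarrow> walsh_group \<Rightarrow> real"
  where "walsh n x = (\<Prod>k. rademacher k x ^ digit n k)"

definition dyadic_algebra :: "nat \<Rightarrow> walsh_group measure"
  where "dyadic_algebra n = sigma UNIV (range (cyl n))"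

text \<open>
  The martingale property is the defining property of \<open>E (F n | dyadic_algebra m) = F m\<close>,
  because the library's \<^const>\<open>real_cond_exp\<close> is restricted to real-valued functions;
  see \<open>martingale_iff_real_cond_exp\<close> below for the agreement in that case.
\<close>

definition martingale ::
    "(nat \<Rightarrow> walsh_group \<Rightarrow> 'a::{real_normed_field, banach, second_countable_topology}) \<Rightarrow> bool"
  where "martingale F \<longleftrightarrow>
    (\<forall>n. F n \<in> borel_measurable (dyadic_algebra n) \<and> integrable haar (F n)) \<and>
    (\<forall>m n. m \<le> n \<longrightarrow> (\<forall>A\<in>sets (dyadic_algebra m).
        (\<integral>x\<in>A. F n x \<partial>haar) = (\<integral>x\<in>A. F m x \<partial>haar)))"

text \<open>\<open>ennpowr\<close> is only meant for positive exponents.\<close>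

definition ennpowr :: "ennreal \<Rightarrow> real \<Rightarrow> ennreal"
  where "ennpowr x p = (if x = \<infinity> then \<infinity> else ennreal (enn2real x powr p))"

text \<open>
  The (quasi-)norm is defined for extended nonnegative functions, since maximal functions can be
  infinite at some points; for a scalar function \<open>f\<close> it is applied to \<open>\<lambda>x. ennreal (norm (f x))\<close>.
\<close>

definition Lp_enorm :: "real \<Rightarrow> (walsh_group \<Rightarrow> ennreal) \<Rightarrow> ennreal"
  where "Lp_enorm p g = ennpowr (\<integral>\<^sup>+x. ennpowr (g x) p \<partial>haar) (1 / p)"

definition Lp_norm :: "real \<Rightarrow> (walsh_group \<Rightarrow> 'a::real_normed_vector) \<Rightarrow> ennreal"
  where "Lp_norm p f = Lp_enorm p (\<lambda>x. ennreal (norm (f x)))"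

definition max_fun :: "(nat \<Rightarrow> walsh_group \<Rightarrow> 'a::real_normed_vector) \<Rightarrow> walsh_group \<Rightarrow> ennreal"
  where "max_fun F x = (SUP n. ennreal (norm (F n x)))"

definition Hp_norm :: "real \<Rightarrow> (nat \<Rightarrow> walsh_group \<Rightarrow> 'a::real_normed_vector) \<Rightarrow> ennreal"
  where "Hp_norm p F = Lp_enorm p (max_fun F)"

definition Hp ::
    "real \<Rightarrow> (nat \<Rightarrow> walsh_group \<Rightarrow> 'a::{real_normed_field, banach, second_countable_topology}) set"
  where "Hp p = {F. martingale F \<and> Hp_norm p F < \<infinity>}"

text \<open>The martingale of conditional expectations of an integrable function.\<close>

definition fun_mart ::
    "(walsh_group \<Rightarrow> 'a::{real_normed_field, banach, second_countable_topology}) \<Rightarrow>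
      nat \<Rightarrow> walsh_group \<Rightarrow> 'a"
  where "fun_mart f n x =
    (\<integral>y\<in>cyl n x. f y \<partial>haar) / of_real (measure haar (cyl n x))"

definition fourier_coeff ::
    "(nat \<Rightarrow> walsh_group \<Rightarrow> 'a::{real_normed_field, banach, second_countable_topology}) \<Rightarrow>
      nat \<Rightarrow> 'a"
  where "fourier_coeff F k = lim (\<lambda>n. \<integral>x. F n x * of_real (walsh k x) \<partial>haar)"

definition partial_sum ::
    "nat \<Rightarrow> (nat \<Rightarrow> walsh_group \<Rightarrow> 'a::{real_normed_field, banach, second_countable_topology}) \<Rightarrow>
      walsh_group \<Rightarrow> 'a"
  where "partial_sum n F x = (\<Sum>k<n. fourier_coeff F k * of_real (walsh k x))"

definition fejer ::
    "nat \<Rightarrow> (nat \<Rightarrow> walsh_group \<Rightarrow> 'a::{real_normed_field, banach, second_countable_topology}) \<Rightarrow>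
      walsh_group \<Rightarrow> 'a"
  where "fejer n F x = (\<Sum>k=1..n. partial_sum k F x) / of_nat n"

text \<open>The infinite sum and product above are finite.\<close>

lemma digit_eq_0: "n \<le> k \<Longrightarrow> digit n k = 0"
  unfolding digit_def by (metis div_less le_less_trans less_exp mod_0)

lemma variation_eq_finite:
  "variation n = real (digit n 0) + (\<Sum>k<n. \<bar>real (digit n (Suc k)) - real (digit n k)\<bar>)"
  unfolding variation_def by (subst suminf_finite[of "{..<n}"]) (auto simp: digit_eq_0)

lemma walsh_eq_finite: "walsh n x = (\<Prod>k<n. rademacher k x ^ digit n k)"
  unfolding walsh_def by (rule prodinf_finite) (auto simp: digit_eq_0)

lemma UNIV_bit: "(UNIV :: bit set) = {0, 1}"
  by (auto intro: bit.exhaust)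

lemma finite_UNIV_bit [simp]: "finite (UNIV :: bit set)"
  by (simp add: UNIV_bit)

lemma product_prob_space_bit:
  "product_prob_space (\<lambda>_::nat. uniform_count_measure (UNIV :: bit set))"
  by (intro product_prob_spaceI prob_space_uniform_count_measure) auto

lemma prob_space_haar: "prob_space haar"
  unfolding haar_def by (intro prob_space_PiM prob_space_uniform_count_measure) auto

lemma space_haar [simp]: "space haar = UNIV"
  by (simp add: haar_def space_PiM PiE_UNIV_domain space_uniform_count_measure)

lemma prod_emb_bit:
  "prod_emb UNIV (\<lambda>_::nat. uniform_count_measure (UNIV :: bit set)) J (\<Pi>\<^sub>E j\<in>J. B j) =
    {x. \<forall>j\<in>J. x j \<in> B j}"
  by (auto simp: prod_emb_def space_PiM space_uniform_count_measure PiE_UNIV_domain PiE_iff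
      restrict_def extensional_def)

text \<open>The measure is invariant under the group translations.\<close>

lemma haar_translation_invariant: "distr haar haar (\<lambda>x j. a j + x j) = haar"
proof -
  interpret product_prob_space "\<lambda>_::nat. uniform_count_measure (UNIV :: bit set)" UNIV
    by (rule product_prob_space_bit)
  let ?M = "\<lambda>_::nat. uniform_count_measure (UNIV :: bit set)"
  let ?T = "\<lambda>(x::walsh_group) j. a j + x j"
  have T: "?T \<in> measurable haar haar"
    unfolding haar_def
    by (rule measurable_PiM_single', rule measurable_compose[OF measurable_component_singleton])
      (auto simp: space_PiM space_uniform_count_measure sets_uniform_count_measure measurable_def)
  show ?thesis
    unfolding haar_def
  proof (rule PiM_eq)
    fix J :: "nat set" and A :: "nat \<Rightarrow> bit set"
    assume J: "finite J"
    note emb = prod_emb_bit[of J]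
    have meas: "emeasure (Pi\<^sub>M UNIV ?M) {x. \<forall>j\<in>J. x j \<in> B j} = (\<Prod>j\<in>J. emeasure (?M j) (B j))" for B
      using emeasure_PiM_emb[of J B] J by (simp add: emb sets_uniform_count_measure)
    have sets: "{x. \<forall>j\<in>J. x j \<in> A j} \<in> sets (Pi\<^sub>M UNIV ?M)"
      unfolding emb[symmetric] using J
      by (intro sets_PiM_I) (auto simp: sets_uniform_count_measure)
    have inj: "inj_on ((+) (a j)) X" for j X
      by (auto simp: inj_on_def)
    have pre: "?T -` {x. \<forall>j\<in>J. x j \<in> A j} = {x. \<forall>j\<in>J. x j \<in> (+) (a j) ` A j}"
    proof -
      have "a j + y \<in> A j \<longleftrightarrow> y \<in> (+) (a j) ` A j" for j y
      proof -
        have "y = a j + (a j + y)" by (cases "a j"; cases y) auto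
        moreover have "a j + (a j + z) = z" for z by (cases "a j"; cases z) auto
        ultimately show ?thesis by (metis imageE imageI)
      qed
      then show ?thesis by auto
    qed
    have "emeasure (distr (Pi\<^sub>M UNIV ?M) (Pi\<^sub>M UNIV ?M) ?T) {x. \<forall>j\<in>J. x j \<in> A j} =
        emeasure (Pi\<^sub>M UNIV ?M) (?T -` {x. \<forall>j\<in>J. x j \<in> A j} \<inter> space (Pi\<^sub>M UNIV ?M))"
      using T sets unfolding haar_def by (rule emeasure_distr)
    also have "\<dots> = (\<Prod>j\<in>J. emeasure (?M j) ((+) (a j) ` A j))"
      unfolding pre space_haar[unfolded haar_def] Int_UNIV_right by (rule meas)
    also have "\<dots> = (\<Prod>j\<in>J. emeasure (?M j) (A j))"
      by (intro prod.cong refl)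
        (simp only: emeasure_uniform_count_measure[OF finite_UNIV_bit subset_UNIV] card_image[OF inj])
    finally show "emeasure (distr (Pi\<^sub>M UNIV ?M) (Pi\<^sub>M UNIV ?M) ?T) (prod_emb UNIV ?M J (\<Pi>\<^sub>E j\<in>J. A j))
        = (\<Prod>j\<in>J. emeasure (?M j) (A j))"
      by (simp add: emb)
  qed simp
qed

lemma cyl_in_sets_haar: "cyl n x \<in> sets haar"
proof -
  let ?M = "\<lambda>_::nat. uniform_count_measure (UNIV :: bit set)"
  have eq: "cyl n x = prod_emb UNIV ?M {..<n} (\<Pi>\<^sub>E j\<in>{..<n}. {x j})"
    unfolding prod_emb_bit cyl_def Ball_def lessThan_iff singleton_iff ..
  show ?thesis
    unfolding eq haar_def by (rule sets_PiM_I) (simp_all add: sets_uniform_count_measure)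
qed

lemma subalgebra_dyadic: "subalgebra haar (dyadic_algebra n)"
proof -
  have "sigma_sets UNIV (range (cyl n)) \<subseteq> sets haar"
    using sets.sigma_sets_subset[of "range (cyl n)" haar] cyl_in_sets_haar by auto
  then show ?thesis
    by (simp add: subalgebra_def dyadic_algebra_def space_measure_of_conv)
qed

lemma martingale_iff_real_cond_exp:
  fixes F :: "nat \<Rightarrow> walsh_group \<Rightarrow> real"
  shows "martingale F \<longleftrightarrow>
    (\<forall>n. F n \<in> borel_measurable (dyadic_algebra n) \<and> integrable haar (F n)) \<and>
    (\<forall>m n. m \<le> n \<longrightarrow> (AE x in haar. real_cond_exp haar (dyadic_algebra m) (F n) x = F m x))"
    (is "_ \<longleftrightarrow> ?M \<and> ?C")
proof -
  have sf: "finite_measure_subalgebra haar (dyadic_algebra m)" for m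
    using prob_space_haar subalgebra_dyadic
    by (auto simp: finite_measure_subalgebra_def finite_measure_subalgebra_axioms_def
        prob_space.finite_measure)
  have "(AE x in haar. real_cond_exp haar (dyadic_algebra m) (F n) x = F m x) \<longleftrightarrow>
      (\<forall>A\<in>sets (dyadic_algebra m). (\<integral>x\<in>A. F n x \<partial>haar) = (\<integral>x\<in>A. F m x \<partial>haar))"
    if M: ?M for m n
  proof -
    interpret finite_measure_subalgebra haar "dyadic_algebra m" by (rule sf)
    show ?thesis
    proof
      assume AE: "AE x in haar. real_cond_exp haar (dyadic_algebra m) (F n) x = F m x"
      show "\<forall>A\<in>sets (dyadic_algebra m). (\<integral>x\<in>A. F n x \<partial>haar) = (\<integral>x\<in>A. F m x \<partial>haar)"
      proof
        fix A assume A: "A \<in> sets (dyadic_algebra m)"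
        have Ah: "A \<in> sets haar" using A subalg by (auto simp: subalgebra_def)
        have [measurable]: "F m \<in> borel_measurable haar" using M by auto
        have [measurable]: "real_cond_exp haar (dyadic_algebra m) (F n) \<in> borel_measurable haar"
          by (rule borel_measurable_cond_exp2)
        have "(\<integral>x\<in>A. F n x \<partial>haar) = (\<integral>x\<in>A. real_cond_exp haar (dyadic_algebra m) (F n) x \<partial>haar)"
          using real_cond_exp_intA[OF _ A, of "F n"] M by auto
        also have "\<dots> = (\<integral>x\<in>A. F m x \<partial>haar)"
          unfolding set_lebesgue_integral_def using AE Ah
          by (intro integral_cong_AE) auto
        finally show "(\<integral>x\<in>A. F n x \<partial>haar) = (\<integral>x\<in>A. F m x \<partial>haar)" .
      qed
    next
      assume "\<forall>A\<in>sets (dyadic_algebra m). (\<integral>x\<in>A. F n x \<partial>haar) = (\<integral>x\<in>A. F m x \<partial>haar)"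
      then show "AE x in haar. real_cond_exp haar (dyadic_algebra m) (F n) x = F m x"
        using M by (intro real_cond_exp_charact) auto
    qed
  qed
  then show ?thesis
    unfolding martingale_def by blast
qed

end

theory Submission
  imports Defs
begin

text \<open>
  Write \<open>K\<close> for \<open>n\<close> times the Fejer kernel of order \<open>n\<close>, called \<open>fejer_sum n\<close> below. Since the exponent is
  \<open>1/2\<close>, both parts reduce to one quantity, the integral of the square root of \<open>\<bar>K\<bar>\<close>, and to the
  fact that, up to an additive constant, this integral is comparable to the variation of \<open>n\<close>.

  The upper bound (\<open>root_int_fejer_sum_changes\<close>) uses that the number \<open>2 ^ A - 1 - m\<close> arises from \<open>m\<close> by
  flipping its lowest \<open>A\<close> digits: the kernels of both orders differ, up to a Walsh factor, by terms whose
  square roots have bounded integrals. Each change of digits of \<open>n\<close> is removed by one such step. The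
  lower bound (\<open>root_int_fejer_sum_ge\<close>) looks at the places where the digits rise from \<open>0\<close> to \<open>1\<close>; each
  of them carries a set on which \<open>\<bar>K\<bar>\<close> is large, and these sets are disjoint.

  For the boundedness, the Fejer mean is written as a convolution over a finite group with about
  \<open>n\<close> elements. As the square root is subadditive, it can be moved inside, and the integral of the square root of the mean is at
  most a constant times \<open>variation n\<close> times the integral of the square root of the maximal function
  (\<open>integral_root_fejer_le\<close>). Squaring gives the factor \<open>V\<^sup>2(n)\<close>. For the Hardy norm one needs
  all conditional expectations of the mean; those are either the mean itself or weighted averages of a
  dyadic Fejer mean and the martingale (\<open>fun_mart_fejer\<close>). The dyadic means are explicit averages
  over translates by unit vectors, and their supremum is controlled by decomposing the running maximum of the martingale
  into nonnegative jumps (\<open>sum_shifted_root_max_le\<close>).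

  The martingale with unbounded means is a lacunary series of atoms, the atom at the level \<open>M\<close> being a block of
  equal coefficients of the orders from \<open>2 ^ M\<close> to \<open>2 ^ (M + 1) - 1\<close>. Cutting such a block at \<open>n\<close> produces the
  Fejer kernel of order \<open>n - 2 ^ M\<close>, so the lower bound for the kernel becomes a lower bound for the mean
  (\<open>integral_root_fejer_block_martingale_ge\<close>). A recursive choice of the levels makes each new atom
  dominate its predecessors.
\<close>

section \<open>Binary digits and Walsh functions\<close>

lemma digit_0: "digit n 0 = n mod 2"
  by (simp add: digit_def)

lemma digit_Suc: "digit n (Suc j) = digit (n div 2) j"
  by (simp add: digit_def div_mult2_eq)

lemma digit_le_1: "digit n j \<le> 1"
  by (simp add: digit_def)

lemma digit_eq_0_if_less: "n < 2 ^ A \<Longrightarrow> A \<le> j \<Longrightarrow> digit n j = 0"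
proof -
  assume "n < 2 ^ A" "A \<le> j"
  then have "n < 2 ^ j" using power_increasing[of A j "2::nat"] by linarith
  then show ?thesis by (simp add: digit_def)
qed

lemma digit_zero [simp]: "digit 0 j = 0"
  by (simp add: digit_def)

lemma digit_top:
  assumes "k < 2 ^ A"
  shows "digit (2 ^ A + k) j = (if j = A then 1 else digit k j)"
  using assms
proof (induction A arbitrary: k j)
  case 0
  then show ?case by (cases j) (auto simp: digit_0 digit_Suc)
next
  case (Suc A)
  have *: "(2 ^ Suc A + k) div 2 = 2 ^ A + k div 2" "k div 2 < 2 ^ A"
    using Suc.prems by auto
  show ?case
  proof (cases j)
    case 0
    then show ?thesis by (simp add: digit_0)
  next
    case j: (Suc j')
    show ?thesis unfolding j digit_Suc * using Suc.IH[OF *(2)] by simp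
  qed
qed

text \<open>
  Flipping the lowest \<open>A\<close> digits preserves the places where consecutive digits differ, except
  at the top; this is what makes the variation of a number, rather than the number of its nonzero digits, the right quantity below.
\<close>

lemma digit_complement:
  assumes "k < 2 ^ A" "j < A"
  shows "digit (2 ^ A - 1 - k) j = 1 - digit k j"
  using assms
proof (induction A arbitrary: k j)
  case (Suc A)
  have halve: "(2 * N - 1 - k) div 2 = N - 1 - k div 2" "(2 * N - 1 - k) mod 2 = 1 - k mod 2"
    if k: "k < 2 * N" for N :: nat
  proof -
    define d where "d = N - 1 - k div 2"
    have "N = k div 2 + 1 + d" using k by (auto simp: d_def)
    moreover have "k = 2 * (k div 2) + k mod 2" "k mod 2 < 2" by simp_all
    ultimately have eq: "2 * N - 1 - k = 2 * d + (1 - k mod 2)" and "1 - k mod 2 < 2" by linarith+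
    moreover have "(2 * d + b) div 2 = d" "(2 * d + b) mod 2 = b" if "b < 2" for b :: nat
      using that by auto
    ultimately have "(2 * N - 1 - k) div 2 = d" "(2 * N - 1 - k) mod 2 = 1 - k mod 2"
      unfolding eq by blast+
    then show "(2 * N - 1 - k) div 2 = N - 1 - k div 2" "(2 * N - 1 - k) mod 2 = 1 - k mod 2"
      by (simp_all only: d_def)
  qed
  have *: "(2 ^ Suc A - 1 - k) div 2 = 2 ^ A - 1 - k div 2" "k div 2 < 2 ^ A"
    using Suc.prems(1) halve(1)[of "2 ^ A"] by simp_all
  show ?case
  proof (cases j)
    case 0
    have "(2 ^ Suc A - 1 - k) mod 2 = 1 - k mod 2"
      using Suc.prems(1) halve(2)[of "2 ^ A"] by simp
    then show ?thesis using 0 by (simp add: digit_0)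
  next
    case j: (Suc j')
    show ?thesis unfolding j digit_Suc * using Suc.IH[OF *(2)] Suc.prems j by simp
  qed
qed simp

lemma walsh_prod: "n < 2 ^ N \<Longrightarrow> walsh n x = (\<Prod>k<N. rademacher k x ^ digit n k)"
  unfolding walsh_def by (rule prodinf_finite) (auto simp: digit_eq_0_if_less)

lemma rademacher_cases: "rademacher k x = 1 \<or> rademacher k x = - 1"
  by (simp add: rademacher_def)

lemma abs_walsh [simp]: "\<bar>walsh n x\<bar> = 1"
proof -
  have "\<bar>rademacher k x\<bar> = 1" for k by (simp add: rademacher_def)
  then show ?thesis by (simp add: walsh_eq_finite abs_prod power_abs)
qed

lemma walsh_0 [simp]: "walsh 0 x = 1"
  by (simp add: walsh_eq_finite)

lemma walsh_top:
  assumes "k < 2 ^ A"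
  shows "walsh (2 ^ A + k) x = rademacher A x * walsh k x"
proof -
  have "walsh (2 ^ A + k) x = (\<Prod>j<Suc A. rademacher j x ^ digit (2 ^ A + k) j)"
    using assms by (intro walsh_prod) simp
  also have "\<dots> = (\<Prod>j<A. rademacher j x ^ digit k j) * rademacher A x"
    using assms by (simp add: digit_top)
  finally show ?thesis
    using walsh_prod[OF assms, of x] by simp
qed

text \<open>
  For a digit \<open>d\<close> and a value \<open>r\<close> of a Rademacher function, \<open>r ^ (1 - d) = r * r ^ d\<close>, as \<open>r * r = 1\<close>.
\<close>

lemma walsh_complement:
  assumes "k < 2 ^ A"
  shows "walsh (2 ^ A - 1 - k) x = walsh (2 ^ A - 1) x * walsh k x"
proof -
  have "walsh (2 ^ A - 1 - k) x = (\<Prod>j<A. rademacher j x ^ (1 - digit k j))"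
    using assms by (subst walsh_prod[of _ A]) (auto simp: digit_complement simp del: diff_diff_left One_nat_def)
  moreover have "walsh (2 ^ A - 1) x = (\<Prod>j<A. rademacher j x)"
    using digit_complement[of 0 A] by (subst walsh_prod[of _ A]) auto
  moreover have "walsh k x = (\<Prod>j<A. rademacher j x ^ digit k j)"
    using assms by (rule walsh_prod)
  moreover have "rademacher j x ^ (1 - digit k j) = rademacher j x * rademacher j x ^ digit k j" for j
    using digit_le_1[of k j] by (cases "digit k j") (auto simp: rademacher_def)
  ultimately show ?thesis
    by (simp add: prod.distrib)
qed

section \<open>Translations of the Walsh group\<close>

definition gadd :: "walsh_group \<Rightarrow> walsh_group \<Rightarrow> walsh_group" (infixl "\<oplus>" 65)
  where "x \<oplus> y = (\<lambda>j. x j + y j)"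

definition unit_at :: "nat \<Rightarrow> walsh_group"
  where "unit_at s = (\<lambda>j. if j = s then 1 else 0)"

lemma unit_at_same [simp]: "unit_at s s = 1" and unit_at_other [simp]: "j \<noteq> s \<Longrightarrow> unit_at s j = 0"
  by (auto simp: unit_at_def)

lemma bit_add_eq_iff: "(a :: bit) + b = c \<longleftrightarrow> a = b + c"
  by (cases a; cases b; cases c) auto

lemma gadd_apply [simp]: "(x \<oplus> y) j = x j + y j"
  by (simp add: gadd_def)

lemma rademacher_gadd: "rademacher k (x \<oplus> y) = rademacher k x * rademacher k y"
  unfolding rademacher_def gadd_apply by (cases "x k"; cases "y k") auto

lemma walsh_gadd: "walsh n (x \<oplus> y) = walsh n x * walsh n y"
  by (simp add: walsh_eq_finite rademacher_gadd power_mult_distrib prod.distrib)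

text \<open>
  Translation by \<open>unit_at s\<close> changes the sign of exactly the Walsh functions whose index has the
  digit one at \<open>s\<close>. All vanishing integrals below are obtained from such translations.
\<close>

lemma walsh_unit_at: "walsh n (unit_at s) = (- 1) ^ digit n s"
proof -
  have *: "rademacher k (unit_at s) = (if k = s then - 1 else 1)" for k
    by (auto simp: rademacher_def)
  have "walsh n (unit_at s) = (\<Prod>k<n. if k = s then (- 1) ^ digit n k else 1)"
    unfolding walsh_eq_finite * by (intro prod.cong) auto
  also have "\<dots> = (- 1) ^ digit n s"
    by (auto simp: prod.delta digit_eq_0)
  finally show ?thesis .
qed

section \<open>Dirichlet and Fejer kernels\<close>

definition dirichlet :: "nat \<Rightarrow> walsh_group \<Rightarrow> real"
  where "dirichlet n x = (\<Sum>k<n. walsh k x)"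

text \<open>
  This is \<open>n\<close> times the usual Fejer kernel; leaving the factor out keeps the recursions free of
  divisions.
\<close>

definition fejer_sum :: "nat \<Rightarrow> walsh_group \<Rightarrow> real"
  where "fejer_sum n x = (\<Sum>k=1..n. dirichlet k x)"

lemma dirichlet_0 [simp]: "dirichlet 0 x = 0" and
  dirichlet_Suc: "dirichlet (Suc n) x = dirichlet n x + walsh n x"
  by (simp_all add: dirichlet_def)

lemma fejer_sum_0 [simp]: "fejer_sum 0 x = 0" and
  fejer_sum_Suc: "fejer_sum (Suc n) x = fejer_sum n x + dirichlet (Suc n) x"
  by (simp_all add: fejer_sum_def)

lemma abs_dirichlet_le: "\<bar>dirichlet n x\<bar> \<le> n"
  unfolding dirichlet_def using sum_abs[of "\<lambda>k. walsh k x" "{..<n}"] by simp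

lemma abs_fejer_sum_le: "\<bar>fejer_sum n x\<bar> \<le> n * (n + 1) / 2"
proof (induction n)
  case (Suc n)
  have "\<bar>fejer_sum (Suc n) x\<bar> \<le> \<bar>fejer_sum n x\<bar> + \<bar>dirichlet (Suc n) x\<bar>"
    unfolding fejer_sum_Suc by linarith
  then show ?case
    using Suc abs_dirichlet_le[of "Suc n" x] by (simp add: field_simps)
qed simp

lemma dirichlet_top: "m \<le> 2 ^ A \<Longrightarrow>
  dirichlet (2 ^ A + m) x = dirichlet (2 ^ A) x + rademacher A x * dirichlet m x"
proof (induction m)
  case (Suc m)
  then show ?case
    using walsh_top[of m A x] by (simp add: dirichlet_Suc algebra_simps)
qed simp

text \<open>
  Stripping the leading binary digit. The recursion holds up to \<open>m = 2 ^ A\<close>, so that it also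
  produces the doubling step \<open>2 ^ A + 2 ^ A\<close>.
\<close>

lemma fejer_sum_top: "m \<le> 2 ^ A \<Longrightarrow>
  fejer_sum (2 ^ A + m) x = fejer_sum (2 ^ A) x + m * dirichlet (2 ^ A) x + rademacher A x * fejer_sum m x"
proof (induction m)
  case (Suc m)
  have "fejer_sum (2 ^ A + Suc m) x = fejer_sum (2 ^ A + m) x + dirichlet (2 ^ A + Suc m) x"
    by (simp add: fejer_sum_Suc)
  then show ?case
    using Suc by (simp only: dirichlet_top) (simp add: fejer_sum_Suc algebra_simps)
qed simp

lemma dirichlet_complement: "m \<le> 2 ^ A \<Longrightarrow>
  dirichlet (2 ^ A - m) x = dirichlet (2 ^ A) x - walsh (2 ^ A - 1) x * dirichlet m x"
proof (induction m)
  case (Suc m)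
  have "2 ^ A - m = Suc (2 ^ A - Suc m)" using Suc.prems by simp
  then have "dirichlet (2 ^ A - m) x = dirichlet (2 ^ A - Suc m) x + walsh (2 ^ A - 1 - m) x"
    by (simp add: dirichlet_Suc)
  then show ?case
    using Suc walsh_complement[of m A x] by (simp add: dirichlet_Suc algebra_simps)
qed simp

text \<open>
  The kernel of a number and that of its complement within \<open>A\<close> bits agree up to a Walsh factor, of
  modulus one, and two terms of dyadic order, whose square roots have bounded integrals. One
  application removes a whole block of equal leading digits.
\<close>

lemma fejer_sum_complement: "m < 2 ^ A \<Longrightarrow>
  fejer_sum (2 ^ A - 1 - m) x =
    fejer_sum (2 ^ A) x - (m + 1) * dirichlet (2 ^ A) x + walsh (2 ^ A - 1) x * fejer_sum m x"
proof (induction m)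
  case 0
  have "(2::nat) ^ A = Suc (2 ^ A - 1)" by simp
  then show ?case
    using fejer_sum_Suc[of "2 ^ A - 1" x] by simp
next
  case (Suc m)
  have "2 ^ A - 1 - m = Suc (2 ^ A - 1 - Suc m)" using Suc.prems by simp
  then have "fejer_sum (2 ^ A - 1 - m) x = fejer_sum (2 ^ A - 1 - Suc m) x + dirichlet (2 ^ A - Suc m) x"
    by (simp add: fejer_sum_Suc)
  then show ?case
    using Suc dirichlet_complement[of "Suc m" A x] by (simp add: fejer_sum_Suc algebra_simps)
qed

lemma dirichlet_pow2: "dirichlet (2 ^ A) x = (if \<forall>j<A. x j = 0 then 2 ^ A else 0)"
proof (induction A)
  case (Suc A)
  have "dirichlet (2 ^ Suc A) x = (1 + rademacher A x) * dirichlet (2 ^ A) x"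
    using dirichlet_top[of "2 ^ A" A x] by (simp add: mult_2 algebra_simps)
  then show ?case
    by (auto simp: Suc rademacher_def less_Suc_eq)
qed (simp add: dirichlet_Suc)

text \<open>
  The dyadic Fejer kernels are nonnegative combinations of indicators of cylinders: one around
  the origin and one around each unit vector.
\<close>

lemma fejer_sum_pow2: "fejer_sum (2 ^ A) x =
  2 ^ A * (2 ^ A + 1) / 2 * of_bool (\<forall>j<A. x j = 0) +
  (\<Sum>s<A. 2 ^ A * 2 ^ s / 2 * of_bool (\<forall>j<A. x j = unit_at s j))"
proof (induction A)
  case 0
  then show ?case by (simp add: fejer_sum_Suc dirichlet_Suc)
next
  case (Suc A)
  have rec: "fejer_sum (2 ^ Suc A) x = (1 + rademacher A x) * fejer_sum (2 ^ A) x + 2 ^ A * dirichlet (2 ^ A) x"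
    using fejer_sum_top[of "2 ^ A" A x] by (simp add: mult_2 algebra_simps)
  \<comment> \<open>passing to the next power keeps the old unit vectors on the half with \<open>x A = 0\<close> and creates \<open>unit_at A\<close>\<close>
  have old: "(\<forall>j<Suc A. x j = unit_at s j) \<longleftrightarrow> (\<forall>j<A. x j = unit_at s j) \<and> x A = 0" if "s < A" for s
    using that by (auto simp: less_Suc_eq)
  have new: "(\<forall>j<Suc A. x j = unit_at A j) \<longleftrightarrow> (\<forall>j<A. x j = 0) \<and> x A = 1"
    by (auto simp: less_Suc_eq)
  have zero: "(\<forall>j<Suc A. x j = 0) \<longleftrightarrow> (\<forall>j<A. x j = 0) \<and> x A = 0"
    by (auto simp: less_Suc_eq)
  have sums: "(\<Sum>s<Suc A. 2 ^ Suc A * 2 ^ s / 2 * of_bool (\<forall>j<Suc A. x j = unit_at s j)) =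
      of_bool (x A = 0) * (2 * (\<Sum>s<A. 2 ^ A * 2 ^ s / 2 * of_bool (\<forall>j<A. x j = unit_at s j))) +
      2 ^ Suc A * (2 ^ A :: real) / 2 * of_bool ((\<forall>j<A. x j = 0) \<and> x A = 1)"
    unfolding sum.lessThan_Suc new sum_distrib_left
    by (intro arg_cong2[of _ _ _ _ "(+)"] sum.cong refl) (simp_all only: old lessThan_iff, auto)
  show ?case
    unfolding rec Suc.IH dirichlet_pow2 sums zero
    by (cases "x A") (auto simp: rademacher_def field_simps)
qed

text \<open>
  At points whose first two nonzero coordinates are \<open>l - 1\<close> and \<open>l\<close>, the Dirichlet and Fejer kernels of
  order \<open>2 ^ a\<close> vanish for every \<open>a > l\<close>, so that digits above the place \<open>l\<close> only contribute signs.
\<close>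

lemma fejer_sum_strip:
  assumes l: "1 \<le> l" and x: "\<forall>j<l-1. x j = 0" "x (l-1) = 1" "x l = 1"
  shows "\<bar>fejer_sum n x\<bar> = \<bar>fejer_sum (n mod 2 ^ Suc l) x\<bar>"
proof (induction n rule: less_induct)
  case (less n)
  have vanish: "dirichlet (2 ^ a) x = 0" "fejer_sum (2 ^ a) x = 0" if a: "a > l" for a
  proof -
    have "l - 1 < a" using a l by simp
    then have nz: "\<not> (\<forall>j<a. x j = 0)" using x(2) by auto
    have "\<not> (\<forall>j<a. x j = unit_at s j)" for s
    proof
      assume "\<forall>j<a. x j = unit_at s j"
      then have "unit_at s (l - 1) = 1" "unit_at s l = 1" using a \<open>l - 1 < a\<close> x by auto
      then have "s = l - 1" "s = l" by (auto simp: unit_at_def split: if_splits)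
      then show False using l by simp
    qed
    then show "dirichlet (2 ^ a) x = 0" "fejer_sum (2 ^ a) x = 0"
      unfolding dirichlet_pow2 fejer_sum_pow2 using nz by (simp_all only: if_False of_bool_eq) simp
  qed
  show ?case
  proof (cases "n < 2 ^ Suc l")
    case False
    then have "n \<ge> 1" by (cases n) auto
    then obtain a where a: "2 ^ a \<le> n" "n < 2 ^ Suc a"
      using ex_power_ivl1[of 2 n] by auto
    have al: "a > l" 
    proof (rule ccontr)
      assume "\<not> a > l"
      then have "(2::nat) ^ Suc a \<le> 2 ^ Suc l" by (intro power_increasing) auto
      then show False using a(2) False by linarith
    qed
    define m where "m = n - 2 ^ a"
    have m: "n = 2 ^ a + m" "m \<le> 2 ^ a" "m < n" using a by (auto simp: m_def)
    have "\<bar>fejer_sum n x\<bar> = \<bar>fejer_sum m x\<bar>"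
      using fejer_sum_top[OF m(2), of x] vanish[OF al] rademacher_cases[of a x] by (auto simp: m(1))
    moreover have "n mod 2 ^ Suc l = m mod 2 ^ Suc l"
    proof -
      have "(2::nat) ^ Suc l dvd 2 ^ a" using al by (simp add: le_imp_power_dvd Suc_leI del: power_Suc)
      then show ?thesis unfolding m(1) by (simp add: mod_add_eq[symmetric] dvd_imp_mod_0 del: power_Suc)
    qed
    ultimately show ?thesis using less[OF m(3)] by simp
  qed simp
qed

text \<open>
  After the higher digits are stripped, the digit one at \<open>l\<close> contributes exactly \<open>4 ^ l / 4\<close>, while
  the digit zero at \<open>l - 1\<close> leaves a remainder \<open>m < 2 ^ (l - 1)\<close>, whose kernel is at most half of that
  even by the trivial bound.
\<close>

lemma fejer_sum_lower:
  assumes l: "1 \<le> l" and x: "\<forall>j<l-1. x j = 0" "x (l-1) = 1" "x l = 1"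
    and d: "digit n l = 1" "digit n (l-1) = 0"
  shows "\<bar>fejer_sum n x\<bar> \<ge> 4 ^ l / 8"
proof -
  obtain k where k: "l = Suc k" using l by (cases l) auto
  define m where "m = n mod 2 ^ k"
  have mk: "m < 2 ^ k" by (simp add: m_def)
  have n2: "n mod 2 ^ Suc l = 2 ^ l + m"
  proof -
    have "n mod 2 ^ Suc l = 2 ^ l * digit n l + n mod 2 ^ l" 
      using mod_mult2_eq[of n "2 ^ l" 2] by (simp add: digit_def mult.commute)
    moreover have "n mod 2 ^ l = 2 ^ k * digit n k + m"
      using mod_mult2_eq[of n "2 ^ k" 2] by (simp add: digit_def mult.commute k m_def)
    ultimately show ?thesis using d by (simp add: k)
  qed
  have "\<bar>fejer_sum m x\<bar> \<le> real m * (real m + 1) / 2" by (rule abs_fejer_sum_le)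
  also have "\<dots> \<le> 2 ^ k * 2 ^ k / 2"
  proof -
    have "real m + 1 \<le> 2 ^ k" using mk 
      by (metis Suc_leI of_nat_Suc of_nat_le_iff of_nat_numeral of_nat_power add.commute)
    then show ?thesis by (intro divide_right_mono mult_mono) linarith+
  qed
  finally have small: "\<bar>fejer_sum m x\<bar> \<le> 4 ^ l / 8" by (simp add: k flip: power_mult_distrib)
  have big: "fejer_sum (2 ^ l) x = 4 ^ l / 4"
  proof -
    have nz: "\<not> (\<forall>j<l. x j = 0)" using x(2) k by auto
    have "(\<forall>j<l. x j = unit_at s j) \<longleftrightarrow> s = k" if "s < l" for s
      using x(1,2) k that by (auto simp: unit_at_def less_Suc_eq)
    then have "(\<Sum>s<l. 2 ^ l * 2 ^ s / 2 * of_bool (\<forall>j<l. x j = unit_at s j)) =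
        (\<Sum>s<l. if s = k then 2 ^ l * 2 ^ s / 2 else (0::real))"
      by (intro sum.cong) auto
    then show ?thesis unfolding fejer_sum_pow2 using nz by (simp add: k flip: power_mult_distrib)
  qed
  have "dirichlet (2 ^ l) x = 0"
    unfolding dirichlet_pow2 using x(2) k by auto
  then have "fejer_sum (2 ^ l + m) x = fejer_sum (2 ^ l) x + rademacher l x * fejer_sum m x"
    using fejer_sum_top[of m l x] mk k by simp
  then have "\<bar>fejer_sum (2 ^ l + m) x\<bar> \<ge> fejer_sum (2 ^ l) x - \<bar>fejer_sum m x\<bar>"
    using rademacher_cases[of l x] by auto
  then show ?thesis
    using fejer_sum_strip[OF l x, of n] small big unfolding n2 by linarith
qed

section \<open>Integration of functions of finitely many coordinates\<close>

text \<open>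
  A function measurable with respect to the algebra of level \<open>M\<close> is one that depends only on the
  coordinates below \<open>M\<close>. This form makes such functions finite sums over \<open>reps M\<close> and their
  measurability automatic.
\<close>

definition depends_below :: "nat \<Rightarrow> (walsh_group \<Rightarrow> 'b) \<Rightarrow> bool"
  where "depends_below M f \<longleftrightarrow> (\<forall>x y. (\<forall>j<M. x j = y j) \<longrightarrow> f x = f y)"

text \<open>
  One representative of each cylinder of level \<open>M\<close>: the subgroup of points supported below \<open>M\<close>.
\<close>

definition reps :: "nat \<Rightarrow> walsh_group set"
  where "reps M = {x. \<forall>j\<ge>M. x j = 0}"

definition trunc :: "nat \<Rightarrow> walsh_group \<Rightarrow> walsh_group"
  where "trunc M x = (\<lambda>j. if j < M then x j else 0)"

lemma depends_belowD: "depends_below M f \<Longrightarrow> (\<And>j. j < M \<Longrightarrow> x j = y j) \<Longrightarrow> f x = f y"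
  by (simp add: depends_below_def)

lemma depends_below_mono: "depends_below m f \<Longrightarrow> m \<le> M \<Longrightarrow> depends_below M f"
  unfolding depends_below_def by (meson order_less_le_trans)

lemma depends_below_comp: "depends_below M f \<Longrightarrow> depends_below M (\<lambda>x. g (f x))"
  unfolding depends_below_def by metis

lemma depends_below_comp2:
  "depends_below M f \<Longrightarrow> depends_below M g \<Longrightarrow> depends_below M (\<lambda>x. h (f x) (g x))"
  unfolding depends_below_def by metis

lemma depends_below_sum:
  "(\<And>i. i \<in> I \<Longrightarrow> depends_below M (f i)) \<Longrightarrow> depends_below M (\<lambda>x. \<Sum>i\<in>I. f i x)"
  unfolding depends_below_def by (auto intro!: sum.cong)

lemma depends_below_walsh: "n < 2 ^ M \<Longrightarrow> depends_below M (walsh n)"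
  unfolding depends_below_def by (auto simp: walsh_prod rademacher_def intro!: prod.cong)

lemma mem_cyl: "y \<in> cyl n x \<longleftrightarrow> (\<forall>j<n. y j = x j)"
  by (simp add: cyl_def)

lemma depends_below_cyl: "depends_below n (\<lambda>y. y \<in> cyl n x)"
  by (simp add: depends_below_def mem_cyl)

lemma trunc_in_reps: "trunc M x \<in> reps M"
  by (simp add: trunc_def reps_def)

lemma trunc_below: "j < M \<Longrightarrow> trunc M x j = x j"
  by (simp add: trunc_def)

lemma finite_reps: "finite (reps M)"
proof (induction M)
  case 0
  have "reps 0 = {\<lambda>_. 0}" by (auto simp: reps_def)
  then show ?case by simp
next
  case (Suc M)
  have "reps (Suc M) \<subseteq> reps M \<union> (\<lambda>x. x \<oplus> unit_at M) ` reps M"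
  proof
    fix x assume x: "x \<in> reps (Suc M)"
    show "x \<in> reps M \<union> (\<lambda>x. x \<oplus> unit_at M) ` reps M"
    proof (cases "x M = 0")
      case True
      have "x j = 0" if "M \<le> j" for j
        using \<open>x M = 0\<close> x that by (cases "j = M") (auto simp: reps_def)
      then have "x \<in> reps M" by (simp add: reps_def)
      then show ?thesis by simp
    next
      case False
      then have 1: "x M = 1" by simp
      have "x = trunc M x \<oplus> unit_at M"
      proof
        fix j
        consider "j < M" | "j = M" | "Suc M \<le> j" by linarith
        then show "x j = (trunc M x \<oplus> unit_at M) j"
          using 1 x by cases (auto simp: trunc_def reps_def)
      qed
      then show ?thesis using trunc_in_reps by blast
    qed
  qed
  then show ?case using Suc by (meson finite_UnI finite_imageI finite_subset)
qed

lemma reps_in_cyl_iff: "c \<in> reps M \<Longrightarrow> x \<in> cyl M c \<longleftrightarrow> c = trunc M x"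
  by (auto simp: mem_cyl reps_def trunc_def fun_eq_iff)

lemma depends_below_expand:
  fixes f :: "walsh_group \<Rightarrow> 'b::real_vector"
  assumes "depends_below M f"
  shows "f x = (\<Sum>c\<in>reps M. indicator (cyl M c) x *\<^sub>R f c)"
proof -
  have "(\<Sum>c\<in>reps M. indicator (cyl M c) x *\<^sub>R f c) = (\<Sum>c\<in>reps M. if c = trunc M x then f c else 0)"
    by (intro sum.cong) (auto simp: reps_in_cyl_iff indicator_def)
  also have "\<dots> = f (trunc M x)"
    using finite_reps trunc_in_reps by simp
  also have "\<dots> = f x"
    by (rule depends_belowD[OF assms]) (simp add: trunc_below)
  finally show ?thesis by simp
qed

lemma depends_below_expand_ennreal:
  fixes f :: "walsh_group \<Rightarrow> ennreal"
  assumes "depends_below M f"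
  shows "f x = (\<Sum>c\<in>reps M. f c * indicator (cyl M c) x)"
proof -
  have "(\<Sum>c\<in>reps M. f c * indicator (cyl M c) x) = (\<Sum>c\<in>reps M. if c = trunc M x then f c else 0)"
    by (intro sum.cong) (auto simp: reps_in_cyl_iff indicator_def)
  also have "\<dots> = f (trunc M x)"
    using finite_reps trunc_in_reps by simp
  also have "\<dots> = f x"
    by (rule depends_belowD[OF assms]) (simp add: trunc_below)
  finally show ?thesis by simp
qed

lemma emeasure_cyl: "emeasure haar (cyl n x) = ennreal (1 / 2 ^ n)"
proof -
  interpret product_prob_space "\<lambda>_::nat. uniform_count_measure (UNIV :: bit set)" UNIV
    by (rule product_prob_space_bit)
  let ?M = "\<lambda>_::nat. uniform_count_measure (UNIV :: bit set)"
  have eq: "cyl n x = prod_emb UNIV ?M {..<n} (\<Pi>\<^sub>E j\<in>{..<n}. {x j})"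
    unfolding prod_emb_bit cyl_def Ball_def lessThan_iff singleton_iff ..
  have "emeasure haar (cyl n x) = (\<Prod>j<n. emeasure (?M j) {x j})"
    unfolding eq haar_def by (rule emeasure_PiM_emb) (auto simp: sets_uniform_count_measure)
  also have "\<dots> = (\<Prod>j<n. ennreal (1 / 2))"
    by (intro prod.cong refl, subst emeasure_uniform_count_measure) (auto simp: UNIV_bit)
  also have "\<dots> = ennreal (1 / 2 ^ n)"
    unfolding prod_constant by (subst ennreal_power) (simp_all add: power_one_over)
  finally show ?thesis .
qed

lemma measure_cyl: "measure haar (cyl n x) = 1 / 2 ^ n"
  by (simp add: measure_def emeasure_cyl)

lemma cyl_measurable [measurable]: "cyl n x \<in> sets haar"
  by (rule cyl_in_sets_haar)

lemma sets_dyadic_algebra: "A \<in> sets (dyadic_algebra n) \<longleftrightarrow> depends_below n (\<lambda>x. x \<in> A)"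
proof
  assume "A \<in> sets (dyadic_algebra n)"
  then have "A \<in> sigma_sets UNIV (range (cyl n))" by (simp add: dyadic_algebra_def)
  then show "depends_below n (\<lambda>x. x \<in> A)"
  proof (induction A rule: sigma_sets.induct)
    case (Basic a)
    then show ?case by (auto simp: depends_below_cyl)
  next
    case (Union a)
    then show ?case unfolding depends_below_def by blast
  qed (simp_all add: depends_below_def)
next
  assume A: "depends_below n (\<lambda>x. x \<in> A)"
  have "A = (\<Union>c\<in>reps n \<inter> A. cyl n c)"
  proof (intro set_eqI iffI)
    fix x assume "x \<in> A"
    then have "trunc n x \<in> A"
      using depends_belowD[OF A, of x "trunc n x"] by (simp add: trunc_below)
    then show "x \<in> (\<Union>c\<in>reps n \<inter> A. cyl n c)"
      using trunc_in_reps by (auto simp: reps_in_cyl_iff)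
  next
    fix x assume "x \<in> (\<Union>c\<in>reps n \<inter> A. cyl n c)"
    then obtain c where "c \<in> A" "x \<in> cyl n c" by blast
    then show "x \<in> A" using depends_belowD[OF A, of x c] by (simp add: mem_cyl)
  qed
  moreover have "(\<Union>c\<in>reps n \<inter> A. cyl n c) \<in> sets (dyadic_algebra n)"
    by (intro sets.finite_UN) (auto simp: finite_reps dyadic_algebra_def)
  ultimately show "A \<in> sets (dyadic_algebra n)" by simp
qed

lemma depends_below_measurable_dyadic:
  assumes "depends_below n f"
  shows "f \<in> borel_measurable (dyadic_algebra n)"
proof (rule measurableI)
  fix A
  show "f -` A \<inter> space (dyadic_algebra n) \<in> sets (dyadic_algebra n)"
    unfolding sets_dyadic_algebra using assms
    by (simp add: depends_below_def dyadic_algebra_def space_measure_of_conv) metis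
qed simp

lemma depends_below_measurable:
  "depends_below n f \<Longrightarrow> f \<in> borel_measurable haar"
  using measurable_from_subalg[OF subalgebra_dyadic depends_below_measurable_dyadic] .

lemma measurable_dyadic_depends_below:
  fixes f :: "walsh_group \<Rightarrow> 'b::t1_space"
  assumes "f \<in> borel_measurable (dyadic_algebra n)"
  shows "depends_below n f"
  unfolding depends_below_def
proof (intro allI impI)
  fix x y :: walsh_group assume xy: "\<forall>j<n. x j = y j"
  have "f -` {f y} \<inter> space (dyadic_algebra n) \<in> sets (dyadic_algebra n)"
    using assms by (rule measurable_sets) simp
  then have "depends_below n (\<lambda>z. z \<in> f -` {f y})"
    unfolding sets_dyadic_algebra by (simp add: dyadic_algebra_def space_measure_of_conv)
  from depends_belowD[OF this, of x y] show "f x = f y" using xy by simp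
qed

lemma walsh_measurable [measurable]: "walsh n \<in> borel_measurable haar"
  by (rule depends_below_measurable[OF depends_below_walsh]) (rule less_exp)

lemma dirichlet_measurable [measurable]: "dirichlet n \<in> borel_measurable haar"
  unfolding dirichlet_def[abs_def] by measurable

lemma fejer_sum_measurable [measurable]: "fejer_sum n \<in> borel_measurable haar"
  unfolding fejer_sum_def[abs_def] by measurable

lemma nn_integral_depends_below:
  fixes f :: "walsh_group \<Rightarrow> ennreal"
  assumes "depends_below M f"
  shows "(\<integral>\<^sup>+x. f x \<partial>haar) = (\<Sum>c\<in>reps M. f c * ennreal (1 / 2 ^ M))"
  by (subst depends_below_expand_ennreal[OF assms])
    (simp add: nn_integral_sum nn_integral_cmult_indicator emeasure_cyl)

lemma integral_depends_below:
  fixes f :: "walsh_group \<Rightarrow> 'b::{banach, second_countable_topology}"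
  assumes "depends_below M f"
  shows "integrable haar f" and "(\<integral>x. f x \<partial>haar) = (1 / 2 ^ M) *\<^sub>R (\<Sum>c\<in>reps M. f c)"
proof -
  have f: "f = (\<lambda>x. \<Sum>c\<in>reps M. indicator (cyl M c) x *\<^sub>R f c)"
    using depends_below_expand[OF assms] by (rule ext)
  have *: "has_bochner_integral haar (\<lambda>x. indicator (cyl M c) x *\<^sub>R f c) ((1 / 2 ^ M) *\<^sub>R f c)" for c
    using has_bochner_integral_indicator[of "cyl M c" haar "f c"] by (simp add: emeasure_cyl measure_cyl)
  have "has_bochner_integral haar f (\<Sum>c\<in>reps M. (1 / 2 ^ M) *\<^sub>R f c)"
    by (subst f) (intro has_bochner_integral_sum *)
  then show "integrable haar f" "(\<integral>x. f x \<partial>haar) = (1 / 2 ^ M) *\<^sub>R (\<Sum>c\<in>reps M. f c)"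
    by (auto simp: has_bochner_integral_iff scaleR_sum_right)
qed

lemma gadd_measurable [measurable]: "(\<oplus>) a \<in> measurable haar haar"
proof -
  have "(\<lambda>(x::walsh_group) j. a j + x j) \<in> measurable haar haar"
    unfolding haar_def
    by (rule measurable_PiM_single', rule measurable_compose[OF measurable_component_singleton])
      (auto simp: space_PiM space_uniform_count_measure sets_uniform_count_measure measurable_def)
  then show ?thesis by (simp add: gadd_def[abs_def])
qed

lemma distr_gadd: "distr haar haar ((\<oplus>) a) = haar"
  using haar_translation_invariant[of a] by (simp add: gadd_def[abs_def])

lemma nn_integral_gadd:
  fixes f :: "walsh_group \<Rightarrow> ennreal"
  assumes [measurable]: "f \<in> borel_measurable haar"
  shows "(\<integral>\<^sup>+x. f (a \<oplus> x) \<partial>haar) = (\<integral>\<^sup>+x. f x \<partial>haar)"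
  by (subst (2) distr_gadd[of a, symmetric]) (simp add: nn_integral_distr)

lemma integral_gadd:
  fixes f :: "walsh_group \<Rightarrow> 'b::{banach, second_countable_topology}"
  assumes [measurable]: "f \<in> borel_measurable haar"
  shows "(\<integral>x. f (a \<oplus> x) \<partial>haar) = (\<integral>x. f x \<partial>haar)"
  by (subst (2) distr_gadd[of a, symmetric]) (simp add: integral_distr)

text \<open>
  By translation invariance the integral equals its own negative.
\<close>

lemma integral_eq_0_if_antisymmetric:
  fixes f :: "walsh_group \<Rightarrow> 'b::{banach, second_countable_topology}"
  assumes "f \<in> borel_measurable haar" "\<And>x. f (a \<oplus> x) = - f x"
  shows "(\<integral>x. f x \<partial>haar) = 0"
proof -
  have "(\<integral>x. f x \<partial>haar) = - (\<integral>x. f x \<partial>haar)"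
    using integral_gadd[OF assms(1), of a] by (simp add: assms(2))
  then have "2 *\<^sub>R (\<integral>x. f x \<partial>haar) = 0"
    by (simp only: scaleR_2 eq_neg_iff_add_eq_0)
  then show ?thesis by simp
qed

section \<open>Integrals of the square root of the Fejer kernels\<close>

lemma variation_eq_sum:
  assumes "n < 2 ^ A"
  shows "variation n = real (digit n 0) + (\<Sum>k<A. \<bar>real (digit n (Suc k)) - real (digit n k)\<bar>)"
  unfolding variation_def using assms
  by (subst suminf_finite[of "{..<A}"]) (auto simp: digit_eq_0_if_less)

lemma sqrt_sum_le: "(\<And>i. i \<in> I \<Longrightarrow> 0 \<le> f i) \<Longrightarrow> sqrt (sum f I) \<le> (\<Sum>i\<in>I. sqrt (f i))"
proof (induction I rule: infinite_finite_induct)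
  case (insert i I)
  have "sqrt (sum f (insert i I)) \<le> sqrt (f i) + sqrt (sum f I)"
    using insert by (auto intro!: sqrt_add_le_add_sqrt sum_nonneg)
  then show ?case using insert by fastforce
qed auto

text \<open>
  The constant: the sum \<open>G A\<close> satisfies \<open>G (A + 1) = (G A + 1) / sqrt 2\<close>, and \<open>3\<close> is preserved because
  \<open>1 / sqrt 2 \<le> 3 / 4\<close>.
\<close>

lemma geometric_sqrt_le: "(\<Sum>s<A. sqrt (2 ^ s / 2 ^ A)) \<le> 3"
proof (induction A)
  case (Suc A)
  have q: "sqrt (1 / 2) \<le> 3 / 4" by (rule real_le_lsqrt) (auto simp: power2_eq_square)
  have *: "sqrt (2 ^ s / 2 ^ Suc A) = sqrt (1 / 2) * sqrt (2 ^ s / 2 ^ A)" for s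
    by (simp flip: real_sqrt_mult)
  have "(\<Sum>s<Suc A. sqrt (2 ^ s / 2 ^ Suc A)) = sqrt (1 / 2) * ((\<Sum>s<A. sqrt (2 ^ s / 2 ^ A)) + 1)"
    unfolding * sum.lessThan_Suc by (simp add: sum_distrib_left distrib_left)
  also have "\<dots> \<le> 3 / 4 * (3 + 1)"
    using Suc q by (intro mult_mono) (auto intro!: add_nonneg_nonneg sum_nonneg)
  finally show ?case by simp
qed simp

abbreviation root_int :: "(walsh_group \<Rightarrow> real) \<Rightarrow> ennreal"
  where "root_int f \<equiv> \<integral>\<^sup>+x. ennreal (sqrt \<bar>f x\<bar>) \<partial>haar"

lemma nn_integral_indicator_le:
  "c \<ge> 0 \<Longrightarrow> (\<integral>\<^sup>+x. ennreal (c * indicator (cyl n a) x) \<partial>haar) = ennreal (c / 2 ^ n)"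
  by (simp add: ennreal_mult' nn_integral_cmult ennreal_indicator emeasure_cyl flip: ennreal_mult)

text \<open>
  A cylinder of level \<open>A\<close> has measure \<open>2 ^ (- A)\<close> and the value of the kernel there is at most
  \<open>2 ^ A * 2 ^ s\<close>, so the cylinder around \<open>unit_at s\<close> contributes \<open>sqrt (2 ^ s / 2 ^ A)\<close>: a geometric
  sum.
\<close>

lemma root_int_fejer_sum_pow2: "root_int (fejer_sum (2 ^ A)) \<le> ennreal 4"
proof -
  define B where "B x = 2 ^ A * indicator (cyl A (\<lambda>_. 0)) x +
    (\<Sum>s<A. sqrt (2 ^ A * 2 ^ s) * indicator (cyl A (unit_at s)) x)" for x :: walsh_group
  have "sqrt \<bar>fejer_sum (2 ^ A) x\<bar> \<le> B x" for x
  proof -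
    let ?a = "2 ^ A * (2 ^ A + 1) / 2 * of_bool (\<forall>j<A. x j = 0) :: real"
    let ?b = "\<lambda>s. 2 ^ A * 2 ^ s / 2 * of_bool (\<forall>j<A. x j = unit_at s j) :: real"
    have "sqrt \<bar>fejer_sum (2 ^ A) x\<bar> = sqrt (?a + (\<Sum>s<A. ?b s))"
      unfolding fejer_sum_pow2 by (subst abs_of_nonneg) (auto intro!: add_nonneg_nonneg sum_nonneg)
    also have "\<dots> \<le> sqrt ?a + sqrt (\<Sum>s<A. ?b s)"
      by (intro sqrt_add_le_add_sqrt) (auto intro!: sum_nonneg)
    also have "sqrt (\<Sum>s<A. ?b s) \<le> (\<Sum>s<A. sqrt (?b s))"
      by (rule sqrt_sum_le) auto
    also have "(\<Sum>s<A. sqrt (?b s)) \<le> (\<Sum>s<A. sqrt (2 ^ A * 2 ^ s) * indicator (cyl A (unit_at s)) x)"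
      by (intro sum_mono) (auto simp: indicator_def mem_cyl)
    also have "sqrt ?a \<le> 2 ^ A * indicator (cyl A (\<lambda>_. 0)) x"
    proof (cases "\<forall>j<A. x j = 0")
      case True
      have "(2::real) ^ A * (2 ^ A + 1) / 2 \<le> (2 ^ A)\<^sup>2"
        by (simp add: power2_eq_square)
      then have "sqrt (2 ^ A * (2 ^ A + 1) / 2) \<le> 2 ^ A" by (intro real_le_lsqrt) auto
      then show ?thesis using True by (simp add: mem_cyl)
    next
      case False
      then show ?thesis by auto
    qed
    finally show ?thesis by (simp add: B_def)
  qed
  then have "root_int (fejer_sum (2 ^ A)) \<le> (\<integral>\<^sup>+x. ennreal (B x) \<partial>haar)"
    by (intro nn_integral_mono ennreal_leI)
  also have "\<dots> = (\<integral>\<^sup>+x. ennreal (2 ^ A * indicator (cyl A (\<lambda>_. 0)) x) +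
      (\<Sum>s<A. ennreal (sqrt (2 ^ A * 2 ^ s) * indicator (cyl A (unit_at s)) x)) \<partial>haar)"
    unfolding B_def
    by (intro nn_integral_cong, subst ennreal_plus, simp, force intro: sum_nonneg, subst sum_ennreal) auto
  also have "\<dots> = ennreal 1 + (\<Sum>s<A. ennreal (sqrt (2 ^ A * 2 ^ s) / 2 ^ A))"
    using nn_integral_indicator_le[of "2 ^ A" A "\<lambda>_. 0"]
    by (subst nn_integral_add, measurable, subst nn_integral_sum, measurable)
      (simp add: nn_integral_indicator_le del: sum_ennreal)
  also have "\<dots> = ennreal (1 + (\<Sum>s<A. sqrt (2 ^ s / 2 ^ A)))"
  proof -
    have "sqrt (2 ^ A * 2 ^ s) / 2 ^ A = sqrt (2 ^ s / 2 ^ A)" for s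
      by (simp add: real_sqrt_mult real_sqrt_divide field_simps flip: real_sqrt_power)
    then show ?thesis by (simp add: sum_nonneg)
  qed
  also have "\<dots> \<le> ennreal 4"
    using geometric_sqrt_le[of A] by (intro ennreal_leI) simp
  finally show ?thesis .
qed

text \<open>
  \<open>variation n - digit n 0\<close> counts the changes between consecutive digits. Complementing \<open>n\<close> within
  its bit length removes exactly the change at the leading digit and, by \<open>fejer_sum_complement\<close>, costs
  a constant: \<open>4\<close> for the dyadic kernel and \<open>1\<close> for the Dirichlet kernel. Induction over the
  complements then charges \<open>5\<close> to each change.
\<close>

lemma root_int_fejer_sum_changes:
  "root_int (fejer_sum n) \<le> ennreal (5 * (variation n - digit n 0))"
proof (induction n rule: less_induct)
  case (less n)
  show ?case
  proof (cases "n = 0")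
    case True
    then show ?thesis by simp
  next
    case False
    then have "n \<ge> 1" by simp
    then obtain a where a: "2 ^ a \<le> n" "n < 2 ^ Suc a"
      using ex_power_ivl1[of 2 n] by auto
    define m where "m = 2 ^ Suc a - 1 - n"
    have m: "m < 2 ^ a" "m < 2 ^ Suc a" "n = 2 ^ Suc a - 1 - m" "m < n" using a by (auto simp: m_def)
    have dn: "digit n k = 1 - digit m k" if "k < Suc a" for k
      unfolding m(3) using digit_complement[OF m(2) that] .
    have "digit n a = 1" using dn[of a] digit_eq_0_if_less[OF m(1)] by simp
    have "digit n (Suc a) = 0" using digit_eq_0_if_less[OF a(2)] by simp
    have ch: "\<bar>real (digit n (Suc k)) - real (digit n k)\<bar> = \<bar>real (digit m (Suc k)) - real (digit m k)\<bar>"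
      if "k < a" for k
      using that dn[of k] dn[of "Suc k"] digit_le_1[of m k] digit_le_1[of m "Suc k"] by (auto simp: of_nat_diff)
    have var: "variation n - digit n 0 = (variation m - digit m 0) + 1"
      unfolding variation_eq_sum[OF a(2)] variation_eq_sum[OF m(1)] sum.lessThan_Suc
      using ch \<open>digit n a = 1\<close> \<open>digit n (Suc a) = 0\<close> by simp
    have vm: "variation m - digit m 0 \<ge> 0"
      unfolding variation_eq_sum[OF m(1)] by (simp add: sum_nonneg)
    let ?D = "\<lambda>x. (real m + 1) * dirichlet (2 ^ Suc a) x"
    have "sqrt \<bar>fejer_sum n x\<bar> \<le> sqrt \<bar>fejer_sum (2 ^ Suc a) x\<bar> + sqrt \<bar>?D x\<bar> + sqrt \<bar>fejer_sum m x\<bar>" for x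
    proof -
      have "\<bar>fejer_sum n x\<bar> \<le> \<bar>fejer_sum (2 ^ Suc a) x\<bar> + \<bar>?D x\<bar> + \<bar>walsh (2 ^ Suc a - 1) x * fejer_sum m x\<bar>"
        unfolding m(3) fejer_sum_complement[OF m(2)] by linarith
      then have "sqrt \<bar>fejer_sum n x\<bar> \<le> sqrt (\<bar>fejer_sum (2 ^ Suc a) x\<bar> + \<bar>?D x\<bar> + \<bar>fejer_sum m x\<bar>)"
        by (intro real_sqrt_le_mono) (simp only: abs_mult abs_walsh mult_1)
      also have "\<dots> \<le> sqrt (\<bar>fejer_sum (2 ^ Suc a) x\<bar> + \<bar>?D x\<bar>) + sqrt \<bar>fejer_sum m x\<bar>"
        by (intro sqrt_add_le_add_sqrt) auto
      also have "sqrt (\<bar>fejer_sum (2 ^ Suc a) x\<bar> + \<bar>?D x\<bar>) \<le> sqrt \<bar>fejer_sum (2 ^ Suc a) x\<bar> + sqrt \<bar>?D x\<bar>"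
        by (intro sqrt_add_le_add_sqrt) auto
      finally show ?thesis by simp
    qed
    then have "root_int (fejer_sum n) \<le> (\<integral>\<^sup>+x. ennreal (sqrt \<bar>fejer_sum (2 ^ Suc a) x\<bar>) +
        ennreal (sqrt \<bar>?D x\<bar>) + ennreal (sqrt \<bar>fejer_sum m x\<bar>) \<partial>haar)"
      by (intro nn_integral_mono) (simp add: ennreal_leI flip: ennreal_plus del: power_Suc)
    also have "\<dots> = root_int (fejer_sum (2 ^ Suc a)) + root_int ?D + root_int (fejer_sum m)"
      by (simp add: nn_integral_add del: power_Suc)
    also have "root_int ?D \<le> ennreal 1"
    proof -
      have "sqrt \<bar>?D x\<bar> \<le> 2 ^ Suc a * indicator (cyl (Suc a) (\<lambda>_. 0)) x" for x
      proof -
        have "real m + 1 \<le> 2 ^ Suc a"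
          using m(2) by (metis Suc_leI of_nat_Suc of_nat_le_iff of_nat_numeral of_nat_power add.commute)
        then have "(real m + 1) * 2 ^ Suc a \<le> (2 ^ Suc a)\<^sup>2"
          unfolding power2_eq_square by (intro mult_right_mono) auto
        then have "sqrt ((real m + 1) * 2 ^ Suc a) \<le> 2 ^ Suc a"
          by (intro real_le_lsqrt) auto
        then show ?thesis
          unfolding dirichlet_pow2 by (auto simp: mem_cyl indicator_def abs_mult simp del: power_Suc)
      qed
      then have "root_int ?D \<le> (\<integral>\<^sup>+x. ennreal (2 ^ Suc a * indicator (cyl (Suc a) (\<lambda>_. 0)) x) \<partial>haar)"
        by (intro nn_integral_mono ennreal_leI)
      then show ?thesis by (subst (asm) nn_integral_indicator_le) auto
    qed
    also note root_int_fejer_sum_pow2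
    also note less[OF m(4)]
    also have "ennreal 4 + ennreal 1 + ennreal (5 * (variation m - digit m 0)) =
        ennreal (5 * (variation n - digit n 0))"
      unfolding var using vm by (simp add: algebra_simps flip: ennreal_plus ennreal_numeral ennreal_1)
    finally show ?thesis by (simp add: add_mono)
  qed
qed

lemma root_int_fejer_sum_le: "root_int (fejer_sum n) \<le> ennreal (5 * variation n)"
  by (rule order_trans[OF root_int_fejer_sum_changes]) (simp add: ennreal_leI)

section \<open>Rises of the binary expansion and the lower bound\<close>

text \<open>
  The lowest places, other than the place zero, of the blocks of consecutive ones of \<open>n\<close>.
\<close>

definition rises :: "nat \<Rightarrow> nat set"
  where "rises n = {l. 1 \<le> l \<and> digit n l = 1 \<and> digit n (l - 1) = 0}"

lemma finite_rises: "finite (rises n)"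
proof -
  have "rises n \<subseteq> {..n}"
    unfolding rises_def using digit_eq_0[of n]
    by (auto intro!: leI)
  then show ?thesis by (rule finite_subset) simp
qed

text \<open>
  For digits \<open>0\<close> and \<open>1\<close> the absolute difference is twice the indicator of a rise minus the signed
  difference, and the signed differences telescope.
\<close>

lemma variation_le_rises: "variation n \<le> 2 * card (rises n) + 2"
proof -
  have n: "n < 2 ^ n" by (rule less_exp)
  let ?d = "\<lambda>k. real (digit n k)"
  have abs: "\<bar>?d (Suc k) - ?d k\<bar> = 2 * of_bool (Suc k \<in> rises n) - (?d (Suc k) - ?d k)" for k
    using digit_le_1[of n k] digit_le_1[of n "Suc k"] by (auto simp: rises_def le_Suc_eq)
  have "(\<Sum>k<n. \<bar>?d (Suc k) - ?d k\<bar>) = 2 * (\<Sum>k<n. of_bool (Suc k \<in> rises n)) - (?d n - ?d 0)"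
    unfolding abs sum_subtractf[of _ "\<lambda>k. ?d (Suc k) - ?d k"] sum_distrib_left[symmetric]
    using sum_lessThan_telescope[of ?d n] by simp
  also have "(\<Sum>k<n. of_bool (Suc k \<in> rises n)) = real (card {k\<in>{..<n}. Suc k \<in> rises n})"
    by (simp add: Int_def)
  also have "card {k\<in>{..<n}. Suc k \<in> rises n} = card (Suc ` {k\<in>{..<n}. Suc k \<in> rises n})"
    by (simp add: card_image)
  also have "\<dots> \<le> card (rises n)"
    by (intro card_mono finite_rises) auto
  finally show ?thesis
    unfolding variation_eq_sum[OF n] using digit_le_1[of n 0] by simp
qed

lemma card_rises_top:
  assumes "m < 2 ^ M"
  shows "card (rises (2 ^ M + m)) \<le> card (rises m) + 1"
proof -
  have "rises (2 ^ M + m) \<subseteq> insert M (rises m)"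
    using assms by (auto simp: rises_def digit_top split: if_splits)
  then have "card (rises (2 ^ M + m)) \<le> card (insert M (rises m))"
    by (intro card_mono) (auto simp: finite_rises)
  then show ?thesis using card_insert_le_m1[of "Suc (card (rises m))"] 
    by (simp add: card_insert_if finite_rises split: if_splits)
qed

text \<open>
  Each rise \<open>l\<close> yields a set of measure \<open>2 ^ (- l - 1)\<close> on which the square root of the kernel is at
  least of order \<open>2 ^ l\<close>. These sets are disjoint, because \<open>l - 1\<close> is the first nonzero coordinate of
  their points, so every rise contributes the same constant.
\<close>

lemma root_int_fejer_sum_ge: "root_int (fejer_sum n) \<ge> ennreal (card (rises n) / (4 * sqrt 2))"
proof -
  \<comment> \<open>the points that start with \<open>l - 1\<close> zeros followed by two ones\<close>
  define E where "E l = cyl (Suc l) (unit_at (l - 1) \<oplus> unit_at l)" for l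
  \<comment> \<open>the square root of the lower bound \<open>4 ^ l / 8\<close>\<close>
  define c :: "nat \<Rightarrow> real" where "c l = 2 ^ l / (2 * sqrt 2)" for l
  have E: "(\<forall>j<l-1. x j = 0)" "x (l-1) = 1" "x l = 1" if "x \<in> E l" "1 \<le> l" for x l
    using that by (auto simp: E_def mem_cyl)
  have lower: "c l \<le> sqrt \<bar>fejer_sum n x\<bar>" if "l \<in> rises n" "x \<in> E l" for l x
  proof -
    have "c l = sqrt (4 ^ l / 8)"
      unfolding c_def by (rule real_sqrt_unique[symmetric])
        (simp_all add: power_divide power_mult_distrib power2_eq_square flip: power_mult_distrib)
    also have "\<dots> \<le> sqrt \<bar>fejer_sum n x\<bar>"
      using that E[of x l] by (intro real_sqrt_le_mono fejer_sum_lower[of l]) (auto simp: rises_def)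
    finally show ?thesis .
  qed
  have disj: "l = l'" if "x \<in> E l" "x \<in> E l'" "1 \<le> l" "1 \<le> l'" for x l l'
  proof (rule ccontr)
    assume "l \<noteq> l'"
    then have "l - 1 < l' - 1 \<or> l' - 1 < l - 1" using that(3,4) by linarith
    then show False using E[OF that(1,3)] E[OF that(2,4)] by auto
  qed
  have pt: "(\<Sum>l\<in>rises n. c l * indicator (E l) x) \<le> sqrt \<bar>fejer_sum n x\<bar>" for x
  proof (cases "\<exists>l\<in>rises n. x \<in> E l")
    case True
    then obtain l where l: "l \<in> rises n" "x \<in> E l" by blast
    have "(\<Sum>k\<in>rises n. c k * indicator (E k) x) = (\<Sum>k\<in>rises n. if k = l then c l else 0)"
    proof (intro sum.cong refl)
      fix k assume k: "k \<in> rises n"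
      then have "x \<in> E k \<longleftrightarrow> k = l"
        using l disj[OF l(2), of k] unfolding rises_def by blast
      then show "c k * indicator (E k) x = (if k = l then c l else 0)"
        by (simp add: indicator_def)
    qed
    then show ?thesis using lower[OF l] l finite_rises by simp
  next
    case False
    then have "(\<Sum>l\<in>rises n. c l * indicator (E l) x) = 0"
      by (intro sum.neutral) (auto simp: indicator_def)
    then show ?thesis by simp
  qed
  have c0: "c l \<ge> 0" for l by (simp add: c_def)
  have "ennreal (card (rises n) / (4 * sqrt 2)) = ennreal (\<Sum>l\<in>rises n. c l / 2 ^ Suc l)"
    by (simp add: c_def)
  also have "\<dots> = (\<Sum>l\<in>rises n. ennreal (c l / 2 ^ Suc l))"
    using c0 by (intro sum_ennreal[symmetric]) auto
  also have "\<dots> = (\<Sum>l\<in>rises n. \<integral>\<^sup>+x. ennreal (c l * indicator (E l) x) \<partial>haar)"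
    unfolding E_def using c0 by (intro sum.cong refl nn_integral_indicator_le[symmetric])
  also have "\<dots> = (\<integral>\<^sup>+x. (\<Sum>l\<in>rises n. ennreal (c l * indicator (E l) x)) \<partial>haar)"
    by (rule nn_integral_sum[symmetric]) (simp add: E_def)
  also have "\<dots> = (\<integral>\<^sup>+x. ennreal (\<Sum>l\<in>rises n. c l * indicator (E l) x) \<partial>haar)"
    using c0 by (intro nn_integral_cong sum_ennreal) auto
  also have "\<dots> \<le> root_int (fejer_sum n)"
    using pt by (intro nn_integral_mono ennreal_leI)
  finally show ?thesis .
qed

section \<open>Martingales and Walsh series\<close>

lemma martingale_depends_below: "martingale F \<Longrightarrow> depends_below n (F n)"
  unfolding martingale_def by (intro measurable_dyadic_depends_below) auto

lemma depends_below_mult_walsh: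
  fixes g :: "walsh_group \<Rightarrow> 'a::real_normed_field"
  assumes g: "depends_below m g" and M: "m \<le> M" "k < 2 ^ M"
  shows "depends_below M (\<lambda>x. g x * of_real (walsh k x))"
  using depends_below_comp2[OF depends_below_mono[OF g M(1)] depends_below_walsh[OF M(2)],
      where h = "\<lambda>u v. u * of_real v"] .

lemma less_pow2_add: "k < 2 ^ (m + k)"
  proof -
  have "(2::nat) ^ k \<le> 2 ^ (m + k)" by (intro power_increasing) auto
  then show ?thesis using less_exp[of k] by linarith
qed

lemma cyl_in_dyadic_algebra: "cyl m x \<in> sets (dyadic_algebra m)"
  by (simp add: sets_dyadic_algebra depends_below_cyl)

lemma martingale_set_integral:
  "martingale F \<Longrightarrow> m \<le> n \<Longrightarrow> A \<in> sets (dyadic_algebra m) \<Longrightarrow>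
    (\<integral>x\<in>A. F n x \<partial>haar) = (\<integral>x\<in>A. F m x \<partial>haar)"
  unfolding martingale_def by blast

text \<open>
  The function \<open>g\<close> is a finite combination of indicators of cylinders of level \<open>m\<close>, for which the
  equality is the martingale property.
\<close>

lemma martingale_integral_mult:
  fixes F :: "nat \<Rightarrow> walsh_group \<Rightarrow> 'a::{real_normed_field, banach, second_countable_topology}"
  assumes F: "martingale F" and mn: "m \<le> n" and g: "depends_below m g"
  shows "(\<integral>x. F n x * of_real (g x) \<partial>haar) = (\<integral>x. F m x * of_real (g x) \<partial>haar)"
proof -
  have expand: "F k x * of_real (g x) = (\<Sum>c\<in>reps m. g c *\<^sub>R (indicator (cyl m c) x *\<^sub>R F k x))" for k x
    by (subst depends_below_expand[OF g]) (simp add: of_real_sum sum_distrib_left scaleR_conv_of_real mult_ac)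
  have int: "integrable haar (\<lambda>x. indicator (cyl m c) x *\<^sub>R F k x)" for c k
    using F by (intro integrable_mult_indicator) (auto simp: martingale_def)
  have eq: "(\<integral>x. F k x * of_real (g x) \<partial>haar) = (\<Sum>c\<in>reps m. g c *\<^sub>R (\<integral>x\<in>cyl m c. F k x \<partial>haar))" for k
  proof -
    have "(\<integral>x. F k x * of_real (g x) \<partial>haar) =
        (\<Sum>c\<in>reps m. \<integral>x. g c *\<^sub>R (indicator (cyl m c) x *\<^sub>R F k x) \<partial>haar)"
      unfolding expand by (rule Bochner_Integration.integral_sum) (rule integrable_scaleR_right, rule int)
    then show ?thesis
      by (simp only: integral_scaleR_right set_lebesgue_integral_def)
  qed
  have "(\<integral>x\<in>cyl m c. F n x \<partial>haar) = (\<integral>x\<in>cyl m c. F m x \<partial>haar)" for c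
    by (rule martingale_set_integral[OF F mn cyl_in_dyadic_algebra])
  then show ?thesis
    unfolding eq by simp
qed

lemma martingale_fun_mart:
  fixes F :: "nat \<Rightarrow> walsh_group \<Rightarrow> 'a::{real_normed_field, banach, second_countable_topology}"
  assumes F: "martingale F" and mn: "m \<le> n"
  shows "fun_mart (F n) m x = F m x"
proof -
  have "(\<integral>y\<in>cyl m x. F n y \<partial>haar) = (\<integral>y\<in>cyl m x. F m y \<partial>haar)"
    by (rule martingale_set_integral[OF F mn cyl_in_dyadic_algebra])
  also have "\<dots> = (\<integral>y. indicator (cyl m x) y *\<^sub>R F m x \<partial>haar)"
  proof -
    have "F m y = F m x" if "y \<in> cyl m x" for y
      by (rule depends_belowD[OF martingale_depends_below[OF F]]) (use that in \<open>simp add: mem_cyl\<close>)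
    then show ?thesis
      unfolding set_lebesgue_integral_def
      by (intro Bochner_Integration.integral_cong refl) (auto simp: indicator_def)
  qed
  also have "\<dots> = (1 / 2 ^ m) *\<^sub>R F m x"
    by (simp add: measure_cyl emeasure_cyl)
  finally show ?thesis
    by (simp add: fun_mart_def measure_cyl scaleR_conv_of_real)
qed

text \<open>
  The sequence defining the coefficient is constant from the level \<open>M\<close> on, so the limit is attained
  there.
\<close>

lemma fourier_coeff_eq_sum:
  fixes F :: "nat \<Rightarrow> walsh_group \<Rightarrow> 'a::{real_normed_field, banach, second_countable_topology}"
  assumes F: "martingale F" and k: "k < 2 ^ M"
  shows "fourier_coeff F k = (1 / 2 ^ M) *\<^sub>R (\<Sum>c\<in>reps M. F M c * of_real (walsh k c))"
proof -
  have "(\<lambda>n. \<integral>x. F n x * of_real (walsh k x) \<partial>haar) \<longlonglongrightarrow> (\<integral>x. F M x * of_real (walsh k x) \<partial>haar)"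
    by (rule tendsto_eventually, rule eventually_sequentiallyI[of M])
      (rule martingale_integral_mult[OF F _ depends_below_walsh[OF k]])
  then have "fourier_coeff F k = (\<integral>x. F M x * of_real (walsh k x) \<partial>haar)"
    unfolding fourier_coeff_def by (rule limI)
  also have "\<dots> = (1 / 2 ^ M) *\<^sub>R (\<Sum>c\<in>reps M. F M c * of_real (walsh k c))"
    by (rule integral_depends_below(2)[OF depends_below_mult_walsh[OF martingale_depends_below[OF F] order_refl k]])
  finally show ?thesis .
qed

definition walsh_sum ::
    "(nat \<Rightarrow> 'a::real_normed_field) \<Rightarrow> nat \<Rightarrow> walsh_group \<Rightarrow> 'a"
  where "walsh_sum c n x = (\<Sum>k<n. c k * of_real (walsh k x))"

lemma partial_sum_eq_walsh_sum: "partial_sum n F = walsh_sum (fourier_coeff F) n"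
  by (simp add: partial_sum_def[abs_def] walsh_sum_def[abs_def])

lemma depends_below_walsh_sum: "n \<le> 2 ^ M \<Longrightarrow> depends_below M (walsh_sum c n)"
  unfolding walsh_sum_def[abs_def]
  by (intro depends_below_sum depends_below_mult_walsh[of 0]) (auto simp: depends_below_def)

lemma exists_digit_ge: "2 ^ m \<le> k \<Longrightarrow> \<exists>s\<ge>m. digit k s = 1"
proof -
  assume k: "2 ^ m \<le> k"
  moreover have "(1::nat) \<le> 2 ^ m" by simp
  ultimately have "k \<ge> 1" by linarith
  then obtain a where a: "2 ^ a \<le> k" "k < 2 ^ Suc a"
    using ex_power_ivl1[of 2 k] by auto
  have "m \<le> a"
  proof (rule ccontr)
    assume "\<not> m \<le> a"
    then have "(2::nat) ^ Suc a \<le> 2 ^ m" by (intro power_increasing) auto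
    then show False using a(2) k by linarith
  qed
  moreover have "digit k a = 1"
    using digit_top[of "k - 2 ^ a" a a] a by (simp add: le_add_diff_inverse)
  ultimately show ?thesis by blast
qed

lemma integral_mult_walsh_eq_0:
  fixes g :: "walsh_group \<Rightarrow> 'a::{real_normed_field, banach, second_countable_topology}"
  assumes g: "depends_below m g" and k: "2 ^ m \<le> k"
  shows "(\<integral>x. g x * of_real (walsh k x) \<partial>haar) = 0"
proof -
  obtain s where s: "s \<ge> m" "digit k s = 1" using exists_digit_ge[OF k] by blast
  have "depends_below (m + k) (\<lambda>x. g x * of_real (walsh k x))"
    by (rule depends_below_mult_walsh[OF g le_add1 less_pow2_add])
  moreover have "g (unit_at s \<oplus> x) * of_real (walsh k (unit_at s \<oplus> x)) = - (g x * of_real (walsh k x))" for x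
    using depends_belowD[OF g, of "unit_at s \<oplus> x" x] s by (simp add: walsh_gadd walsh_unit_at)
  ultimately show ?thesis
    by (rule integral_eq_0_if_antisymmetric[where a = "unit_at s", OF depends_below_measurable])
qed

text \<open>
  A Walsh function of order at least \<open>2 ^ m\<close> integrates to zero over every set of level \<open>m\<close>, since its
  order has a digit one at some place \<open>s \<ge> m\<close>; hence the dyadic partial sums of an arbitrary Walsh
  series form a martingale.
\<close>

lemma martingale_walsh_sum:
  fixes c :: "nat \<Rightarrow> 'a::{real_normed_field, banach, second_countable_topology}"
  shows "martingale (\<lambda>n. walsh_sum c (2 ^ n))"
  unfolding martingale_def
proof (intro conjI allI impI ballI)
  fix n
  have dep: "depends_below n (walsh_sum c (2 ^ n))" by (rule depends_below_walsh_sum) simp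
  show "walsh_sum c (2 ^ n) \<in> borel_measurable (dyadic_algebra n)" "integrable haar (walsh_sum c (2 ^ n))"
    by (rule depends_below_measurable_dyadic[OF dep], rule integral_depends_below[OF dep])
next
  fix m n :: nat and A assume "m \<le> n" and A: "A \<in> sets (dyadic_algebra m)"
  then have le: "(2::nat) ^ m \<le> 2 ^ n" by (intro power_increasing) auto
  let ?g = "\<lambda>k x. (indicator A x *\<^sub>R c k) * of_real (walsh k x)"
  have A': "depends_below m (\<lambda>x. indicator A x *\<^sub>R c k)" for k
    using depends_below_comp[OF A[unfolded sets_dyadic_algebra], of "\<lambda>b. of_bool b *\<^sub>R c k"]
    by (simp add: indicator_def of_bool_def)
  have int: "integrable haar (?g k)" for k
    by (rule integral_depends_below(1)[OF depends_below_mult_walsh[OF A' le_add1 less_pow2_add]])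
  have eq: "(\<integral>x\<in>A. walsh_sum c N x \<partial>haar) = (\<Sum>k<N. \<integral>x. ?g k x \<partial>haar)" for N
    unfolding set_lebesgue_integral_def walsh_sum_def scaleR_sum_right
    using int by (subst Bochner_Integration.integral_sum[symmetric]) auto
  show "(\<integral>x\<in>A. walsh_sum c (2 ^ n) x \<partial>haar) = (\<integral>x\<in>A. walsh_sum c (2 ^ m) x \<partial>haar)"
    unfolding eq using le integral_mult_walsh_eq_0[OF A']
    by (intro sum.mono_neutral_right) auto
qed

lemma integral_walsh_mult:
  "(\<integral>x. walsh j x * walsh k x \<partial>haar) = (if j = k then 1 else 0)"
proof (cases "j = k")
  case True
  have "walsh k x * walsh k x = 1" for x
    using abs_walsh[of k x] by (metis abs_mult_self_eq mult_1)
  moreover have "measure haar UNIV = 1"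
    using prob_space.prob_space[OF prob_space_haar] by simp
  ultimately show ?thesis using True by simp
next
  case False
  have "\<exists>s. digit j s \<noteq> digit k s"
  proof (rule ccontr)
    assume "\<nexists>s. digit j s \<noteq> digit k s"
    then have "digit j = digit k" by auto
    then have "bit j s = bit k s" for s
      by (metis bit_iff_odd digit_def even_iff_mod_2_eq_zero)
    then show False using False bit_eq_iff by blast
  qed
  then obtain s where s: "digit j s \<noteq> digit k s" by blast
  then have "walsh j (unit_at s) * walsh k (unit_at s) = - 1"
    using digit_le_1[of j s] digit_le_1[of k s] by (auto simp: walsh_unit_at le_Suc_eq)
  then have "walsh j (unit_at s \<oplus> x) * walsh k (unit_at s \<oplus> x) = - (walsh j x * walsh k x)" for x
    unfolding walsh_gadd by (metis (no_types, opaque_lifting) mult.assoc mult.commute mult_minus1)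
  then have "(\<integral>x. walsh j x * walsh k x \<partial>haar) = 0"
    by (intro integral_eq_0_if_antisymmetric[where a = "unit_at s"]) measurable
  then show ?thesis using False by simp
qed

lemma fourier_coeff_walsh_sum:
  fixes c :: "nat \<Rightarrow> 'a::{real_normed_field, banach, second_countable_topology}"
  shows "fourier_coeff (\<lambda>n. walsh_sum c (2 ^ n)) k = c k"
proof -
  let ?I = "\<lambda>n. \<integral>x. walsh_sum c (2 ^ n) x * of_real (walsh k x) \<partial>haar"
  have wint: "integrable haar (\<lambda>x. walsh j x * walsh k x)" for j
    using integral_depends_below(1)[OF depends_below_mult_walsh[OF depends_below_walsh[OF less_exp[of j]]
          le_add1 less_pow2_add[of k]]] by simp
  have "?I n = c k" if "k \<le> n" for n
  proof -
    have "k < 2 ^ n" using that less_exp[of n] by linarith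
    have "?I n = (\<integral>x. (\<Sum>j<2^n. (walsh j x * walsh k x) *\<^sub>R c j) \<partial>haar)"
      unfolding walsh_sum_def sum_distrib_right scaleR_conv_of_real of_real_mult by (simp only: mult_ac)
    also have "\<dots> = (\<Sum>j<2^n. (\<integral>x. walsh j x * walsh k x \<partial>haar) *\<^sub>R c j)"
      using wint by (subst Bochner_Integration.integral_sum) auto
    also have "\<dots> = (\<Sum>j<2^n. if j = k then c j else 0)"
      unfolding integral_walsh_mult by (intro sum.cong) auto
    also have "\<dots> = c k" using \<open>k < 2 ^ n\<close> by simp
    finally show ?thesis .
  qed
  then have "?I \<longlonglongrightarrow> c k"
    by (intro tendsto_eventually eventually_sequentiallyI[of k])
  then show ?thesis unfolding fourier_coeff_def by (rule limI)
qed

lemma of_nat_mult_fejer: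
  "n \<ge> 1 \<Longrightarrow> of_nat n * fejer n F x = (\<Sum>k=1..n. partial_sum k F x)"
  by (simp add: fejer_def)

text \<open>
  Double counting: the coefficient of order \<open>k\<close> occurs in the partial sums \<open>k + 1, \<dots>, n\<close>.
\<close>

lemma sum_walsh_sum:
  "(\<Sum>k=1..n. walsh_sum c k x) = (\<Sum>k<n. of_nat (n - k) * c k * of_real (walsh k x))"
proof (induction n)
  case (Suc n)
  have "(\<Sum>k<Suc n. of_nat (Suc n - k) * c k * of_real (walsh k x)) =
      (\<Sum>k<Suc n. of_nat (n - k) * c k * of_real (walsh k x) + c k * of_real (walsh k x))"
    by (intro sum.cong refl) (simp add: Suc_diff_le algebra_simps)
  also have "\<dots> = (\<Sum>k<n. of_nat (n - k) * c k * of_real (walsh k x)) + walsh_sum c (Suc n) x"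
    by (simp add: sum.distrib walsh_sum_def)
  finally show ?case using Suc by simp
qed simp

lemma partial_sum_eq_convolution:
  fixes F :: "nat \<Rightarrow> walsh_group \<Rightarrow> 'a::{real_normed_field, banach, second_countable_topology}"
  assumes F: "martingale F" and n: "n \<le> 2 ^ M"
  shows "partial_sum n F x = (1 / 2 ^ M) *\<^sub>R (\<Sum>c\<in>reps M. F M c * of_real (dirichlet n (c \<oplus> x)))"
proof -
  have "partial_sum n F x = (\<Sum>k<n. (1 / 2 ^ M) *\<^sub>R (\<Sum>c\<in>reps M. F M c * of_real (walsh k (c \<oplus> x))))"
    unfolding partial_sum_def using n
    by (intro sum.cong refl)
      (simp add: fourier_coeff_eq_sum[OF F, of _ M] walsh_gadd sum_distrib_right mult.assoc)
  also have "\<dots> = (1 / 2 ^ M) *\<^sub>R (\<Sum>c\<in>reps M. \<Sum>k<n. F M c * of_real (walsh k (c \<oplus> x)))"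
    by (subst sum.swap) (simp add: scaleR_sum_right)
  finally show ?thesis
    by (simp add: dirichlet_def sum_distrib_left)
qed

text \<open>
  Only the coefficients of order below \<open>n \<le> 2 ^ M\<close> enter, so the Fejer mean is the average over the
  finite group \<open>reps M\<close> of translated kernels, weighted by the martingale at the level \<open>M\<close>.
\<close>

lemma fejer_eq_convolution:
  fixes F :: "nat \<Rightarrow> walsh_group \<Rightarrow> 'a::{real_normed_field, banach, second_countable_topology}"
  assumes F: "martingale F" and n: "1 \<le> n" "n \<le> 2 ^ M"
  shows "of_nat n * fejer n F x =
    (1 / 2 ^ M) *\<^sub>R (\<Sum>c\<in>reps M. F M c * of_real (fejer_sum n (c \<oplus> x)))"
proof -
  have "of_nat n * fejer n F x =
      (\<Sum>k=1..n. (1 / 2 ^ M) *\<^sub>R (\<Sum>c\<in>reps M. F M c * of_real (dirichlet k (c \<oplus> x))))"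
    unfolding of_nat_mult_fejer[OF n(1)] using n
    by (intro sum.cong refl partial_sum_eq_convolution[OF F]) simp
  also have "\<dots> = (1 / 2 ^ M) *\<^sub>R (\<Sum>c\<in>reps M. \<Sum>k=1..n. F M c * of_real (dirichlet k (c \<oplus> x)))"
    by (subst sum.swap) (simp add: scaleR_sum_right)
  finally show ?thesis
    by (simp add: fejer_sum_def sum_distrib_left)
qed

lemma sum_reps_pick:
  fixes f :: "walsh_group \<Rightarrow> 'a::real_normed_field"
  assumes "depends_below m f"
  shows "(\<Sum>c\<in>reps m. f c * of_real (of_bool (\<forall>j<m. (c \<oplus> x) j = a j))) = f (a \<oplus> x)"
proof -
  have iff: "(\<forall>j<m. (c \<oplus> x) j = a j) \<longleftrightarrow> c = trunc m (a \<oplus> x)" if "c \<in> reps m" for c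
  proof -
    have "(\<forall>j<m. (c \<oplus> x) j = a j) \<longleftrightarrow> (a \<oplus> x) \<in> cyl m c"
      by (auto simp: mem_cyl bit_add_eq_iff add.commute)
    then show ?thesis using reps_in_cyl_iff[OF that] by simp
  qed
  have "(\<Sum>c\<in>reps m. f c * of_real (of_bool (\<forall>j<m. (c \<oplus> x) j = a j))) =
      (\<Sum>c\<in>reps m. if c = trunc m (a \<oplus> x) then f c else 0)"
    by (intro sum.cong refl) (simp only: iff, simp)
  also have "\<dots> = f (trunc m (a \<oplus> x))"
    using finite_reps trunc_in_reps by simp
  also have "\<dots> = f (a \<oplus> x)"
    by (rule depends_belowD[OF assms]) (simp add: trunc_below)
  finally show ?thesis .
qed

lemma gadd_zero: "(\<lambda>_. 0) \<oplus> x = x"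
  unfolding gadd_def by (simp only: add_0)

lemma partial_sum_pow2:
  fixes F :: "nat \<Rightarrow> walsh_group \<Rightarrow> 'a::{real_normed_field, banach, second_countable_topology}"
  assumes F: "martingale F"
  shows "partial_sum (2 ^ m) F x = F m x"
proof -
  have dir: "dirichlet (2 ^ m) y = 2 ^ m * of_bool (\<forall>j<m. y j = 0)" for y
    unfolding dirichlet_pow2 by simp
  have "(\<Sum>c\<in>reps m. F m c * of_real (dirichlet (2 ^ m) (c \<oplus> x))) =
      2 ^ m *\<^sub>R (\<Sum>c\<in>reps m. F m c * of_real (of_bool (\<forall>j<m. (c \<oplus> x) j = (\<lambda>_. 0) j)))"
    unfolding dir scaleR_sum_right by (intro sum.cong refl) (simp add: scaleR_conv_of_real)
  also have "\<dots> = 2 ^ m *\<^sub>R F m x"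
    by (subst sum_reps_pick[OF martingale_depends_below[OF F]]) (simp add: gadd_zero)
  finally show ?thesis
    by (simp add: partial_sum_eq_convolution[OF F order_refl])
qed

text \<open>
  The dyadic Fejer mean is an explicit average of the martingale over the translates by unit
  vectors.
\<close>

lemma fejer_pow2:
  fixes F :: "nat \<Rightarrow> walsh_group \<Rightarrow> 'a::{real_normed_field, banach, second_countable_topology}"
  assumes F: "martingale F"
  shows "of_nat (2 ^ m) * fejer (2 ^ m) F x =
    ((2 ^ m + 1) / 2) *\<^sub>R F m x + (\<Sum>s<m. (2 ^ s / 2) *\<^sub>R F m (unit_at s \<oplus> x))"
proof -
  let ?b = "\<lambda>c a. of_real (of_bool (\<forall>j<m. (c \<oplus> x) j = a j)) :: 'a"
  have "F m c * of_real (fejer_sum (2 ^ m) (c \<oplus> x)) =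
      (2 ^ m * (2 ^ m + 1) / 2) *\<^sub>R (F m c * ?b c (\<lambda>_. 0)) +
      (\<Sum>s<m. (2 ^ m * 2 ^ s / 2) *\<^sub>R (F m c * ?b c (unit_at s)))" for c
    unfolding fejer_sum_pow2 scaleR_conv_of_real of_real_add of_real_sum of_real_mult of_real_divide
      distrib_left sum_distrib_left
    by (simp only: mult_ac)
  then have "(\<Sum>c\<in>reps m. F m c * of_real (fejer_sum (2 ^ m) (c \<oplus> x))) =
      (2 ^ m * (2 ^ m + 1) / 2) *\<^sub>R (\<Sum>c\<in>reps m. F m c * ?b c (\<lambda>_. 0)) +
      (\<Sum>c\<in>reps m. \<Sum>s<m. (2 ^ m * 2 ^ s / 2) *\<^sub>R (F m c * ?b c (unit_at s)))"
    by (simp only: sum.distrib scaleR_sum_right)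
  also have "(\<Sum>c\<in>reps m. \<Sum>s<m. (2 ^ m * 2 ^ s / 2) *\<^sub>R (F m c * ?b c (unit_at s))) =
      (\<Sum>s<m. (2 ^ m * 2 ^ s / 2) *\<^sub>R (\<Sum>c\<in>reps m. F m c * ?b c (unit_at s)))"
    by (subst sum.swap) (simp only: scaleR_sum_right)
  finally have "(\<Sum>c\<in>reps m. F m c * of_real (fejer_sum (2 ^ m) (c \<oplus> x))) =
      (2 ^ m * (2 ^ m + 1) / 2) *\<^sub>R F m x + (\<Sum>s<m. (2 ^ m * 2 ^ s / 2) *\<^sub>R F m (unit_at s \<oplus> x))"
    unfolding sum_reps_pick[OF martingale_depends_below[OF F]] gadd_zero .
  then show ?thesis
    by (subst fejer_eq_convolution[OF F _ order_refl])
      (simp_all add: scaleR_add_right scaleR_sum_right del: scaleR_left_distrib)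
qed

text \<open>
  Conditioning to the level \<open>m\<close> cuts the Walsh polynomial off at the order \<open>2 ^ m\<close>. For \<open>2 ^ m \<le> n\<close>
  the weights split as \<open>n - k = (2 ^ m - k) + (n - 2 ^ m)\<close>, which gives a dyadic Fejer mean and a dyadic
  partial sum.
\<close>

lemma fun_mart_fejer:
  fixes F :: "nat \<Rightarrow> walsh_group \<Rightarrow> 'a::{real_normed_field, banach, second_countable_topology}"
  assumes F: "martingale F" and n: "1 \<le> n"
  shows "n \<le> 2 ^ m \<Longrightarrow> fun_mart (fejer n F) m x = fejer n F x"
    and "2 ^ m \<le> n \<Longrightarrow> of_nat n * fun_mart (fejer n F) m x =
      of_nat (2 ^ m) * fejer (2 ^ m) F x + of_nat (n - 2 ^ m) * F m x"
proof -
  let ?c = "fourier_coeff F"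
  \<comment> \<open>the Walsh coefficients of the Fejer mean\<close>
  define p where "p k = of_nat (n - k) * ?c k / of_nat n" for k
  have p: "of_nat n * walsh_sum p N x = (\<Sum>k<N. of_nat (n - k) * ?c k * of_real (walsh k x))" for N x
    using n by (simp add: walsh_sum_def p_def sum_distrib_left)
  have fej: "fejer n F x = walsh_sum p N x" if "n \<le> N" for N x
  proof -
    have "of_nat n * fejer n F x = (\<Sum>k<n. of_nat (n - k) * ?c k * of_real (walsh k x))"
      unfolding of_nat_mult_fejer[OF n] partial_sum_eq_walsh_sum sum_walsh_sum ..
    also have "\<dots> = of_nat n * walsh_sum p N x"
      unfolding p using that by (intro sum.mono_neutral_left) auto
    finally show ?thesis using n by simp
  qed
  \<comment> \<open>any level above both \<open>m\<close> and the bit length of \<open>n\<close>\<close>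
  define N where "N = n + m"
  have "n \<le> 2 ^ N" using less_exp[of N] unfolding N_def by linarith
  then have "fejer n F = walsh_sum p (2 ^ N)" using fej by blast
  then have E: "fun_mart (fejer n F) m x = walsh_sum p (2 ^ m) x"
    using martingale_fun_mart[OF martingale_walsh_sum[of p], of m N] by (simp add: N_def)
  show "fun_mart (fejer n F) m x = fejer n F x" if "n \<le> 2 ^ m"
    unfolding E using fej[OF that] by simp
  show "of_nat n * fun_mart (fejer n F) m x =
      of_nat (2 ^ m) * fejer (2 ^ m) F x + of_nat (n - 2 ^ m) * F m x" if le: "2 ^ m \<le> n"
  proof -
    have "(of_nat (n - k) :: 'a) = of_nat (2 ^ m - k) + of_nat (n - 2 ^ m)" if "k < 2 ^ m" for k
      using le that by (simp flip: of_nat_add)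
    then have "of_nat n * fun_mart (fejer n F) m x =
        (\<Sum>k<2 ^ m. of_nat (2 ^ m - k) * ?c k * of_real (walsh k x)) +
        of_nat (n - 2 ^ m) * walsh_sum ?c (2 ^ m) x"
      unfolding E p unfolding walsh_sum_def sum_distrib_left sum.distrib[symmetric]
      by (intro sum.cong refl) (simp add: distrib_right mult.assoc del: of_nat_diff)
    also have "(\<Sum>k<2 ^ m. of_nat (2 ^ m - k) * ?c k * of_real (walsh k x)) =
        of_nat (2 ^ m) * fejer (2 ^ m) F x"
      by (subst of_nat_mult_fejer) (simp_all only: partial_sum_eq_walsh_sum sum_walsh_sum one_le_power one_le_numeral)
    finally show ?thesis
      using partial_sum_pow2[OF F, of m x] by (simp add: partial_sum_eq_walsh_sum)
  qed
qed

lemma fejer_measurable: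
  fixes F :: "nat \<Rightarrow> walsh_group \<Rightarrow> 'a::{real_normed_field, banach, second_countable_topology}"
  shows "fejer n F \<in> borel_measurable haar"
proof -
  have "k \<le> 2 ^ n" if "k \<le> n" for k
    using that less_exp[of n] by linarith
  then have "depends_below n (fejer n F)"
    unfolding fejer_def[abs_def] partial_sum_eq_walsh_sum
    by (intro depends_below_comp[OF depends_below_sum, where g = "\<lambda>y. y / of_nat n"]
        depends_below_walsh_sum) simp
  then show ?thesis by (rule depends_below_measurable)
qed

section \<open>Square roots of extended nonnegative functions\<close>

lemma ennpowr_ennreal: "0 \<le> a \<Longrightarrow> ennpowr (ennreal a) p = ennreal (a powr p)"
  by (simp add: ennpowr_def)

lemma ennpowr_half: "0 \<le> a \<Longrightarrow> ennpowr (ennreal a) (1 / 2) = ennreal (sqrt a)"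
  by (simp add: ennpowr_ennreal powr_half_sqrt)

lemma ennpowr_2: "0 \<le> a \<Longrightarrow> ennpowr (ennreal a) 2 = ennreal (a\<^sup>2)"
  by (simp add: ennpowr_ennreal)

lemma ennpowr_mono: "x \<le> y \<Longrightarrow> 0 \<le> p \<Longrightarrow> ennpowr x p \<le> ennpowr y p"
proof (cases y)
  case (real r)
  assume xy: "x \<le> y" and p: "0 \<le> p"
  then have "x < \<infinity>" using real by (simp add: le_less_trans)
  then obtain q where q: "0 \<le> q" "x = ennreal q" by (cases x) auto
  then have "q \<le> r" using xy real by (simp only: ennreal_le_iff)
  then have "q powr p \<le> r powr p" using q p by (intro powr_mono2)
  then show ?thesis
    unfolding q(2) real(2) ennpowr_ennreal[OF q(1)] ennpowr_ennreal[OF real(1)] by (rule ennreal_leI)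
qed (simp add: ennpowr_def)

text \<open>
  Bounding the square roots of all members of the family bounds the square root of the supremum;
  this passes from pointwise estimates to maximal functions.
\<close>

lemma ennpowr_half_Sup_le:
  assumes a: "\<And>m. 0 \<le> a m" and R: "\<And>m. ennreal (sqrt (a m)) \<le> R"
  shows "ennpowr (SUP m. ennreal (a m)) (1 / 2) \<le> R"
proof (cases R)
  case (real r)
  have "ennreal (a m) \<le> ennreal (r\<^sup>2)" for m
    using R[of m] real a[of m] by (intro ennreal_leI sqrt_le_D) simp
  then have "(SUP m. ennreal (a m)) \<le> ennreal (r\<^sup>2)" by (intro SUP_least)
  then have "ennpowr (SUP m. ennreal (a m)) (1 / 2) \<le> ennpowr (ennreal (r\<^sup>2)) (1 / 2)"
    by (rule ennpowr_mono) simp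
  then show ?thesis using real by (subst (asm) ennpowr_half) auto
qed simp

lemma root_le_max_fun: "ennreal (sqrt (norm (F m x))) \<le> ennpowr (max_fun F x) (1 / 2)"
proof -
  have "ennpowr (ennreal (norm (F m x))) (1 / 2) \<le> ennpowr (max_fun F x) (1 / 2)"
    unfolding max_fun_def by (intro ennpowr_mono SUP_upper) auto
  then show ?thesis by (simp add: ennpowr_half)
qed

lemma Lp_enorm_half: "Lp_enorm (1 / 2) g = ennpowr (\<integral>\<^sup>+x. ennpowr (g x) (1 / 2) \<partial>haar) 2"
  by (simp add: Lp_enorm_def)

section \<open>Boundedness of the Fejer means\<close>

lemma variation_ge_1:
  assumes "n \<ge> 1"
  shows "variation n \<ge> 1"
proof -
  obtain a where a: "2 ^ a \<le> n" "n < 2 ^ Suc a"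
    using ex_power_ivl1[of 2 n] assms by auto
  have "digit n a = 1" using digit_top[of "n - 2 ^ a" a a] a by (simp add: le_add_diff_inverse)
  moreover have "digit n (Suc a) = 0" using digit_eq_0_if_less[OF a(2)] by simp
  ultimately show ?thesis
    unfolding variation_eq_sum[OF a(2)] sum.lessThan_Suc by (simp add: sum_nonneg)
qed

text \<open>
  The square root is subadditive, so it may be taken inside the convolution over \<open>reps M\<close>. The
  result factorises: with \<open>q = 1 / (n * 2 ^ M)\<close> the constant is \<open>sqrt q * 2 ^ M = sqrt (2 ^ M / n)\<close>, which
  is at most \<open>sqrt 2 \<le> 8 / 5\<close> when \<open>2 ^ M\<close> is comparable to \<open>n\<close>. Thus only the values at one level
  and the integral of the square root of the kernel matter.
\<close>

lemma integral_root_fejer_le: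
  fixes F :: "nat \<Rightarrow> walsh_group \<Rightarrow> 'a::{real_normed_field, banach, second_countable_topology}"
  assumes F: "martingale F" and n: "1 \<le> n" "n \<le> 2 ^ M" "2 ^ M \<le> 2 * n"
  shows "(\<integral>\<^sup>+x. ennreal (sqrt (norm (fejer n F x))) \<partial>haar) \<le>
    ennreal (8 * variation n) * (\<integral>\<^sup>+x. ennreal (sqrt (norm (F M x))) \<partial>haar)"
proof -
  define q where "q = 1 / (real n * 2 ^ M)"
  have q: "q > 0" using n by (simp add: q_def)
  let ?f = "\<lambda>c. sqrt (norm (F M c))"
  let ?g = "\<lambda>x. sqrt \<bar>fejer_sum n x\<bar>"
  have "sqrt (norm (fejer n F x)) \<le> (\<Sum>c\<in>reps M. sqrt q * ?f c * ?g (c \<oplus> x))" for x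
  proof -
    have "real n * norm (fejer n F x) = norm (of_nat n * fejer n F x)"
      by (simp add: norm_mult)
    also have "\<dots> \<le> (1 / 2 ^ M) * (\<Sum>c\<in>reps M. norm (F M c) * \<bar>fejer_sum n (c \<oplus> x)\<bar>)"
      unfolding fejer_eq_convolution[OF F n(1,2)] norm_scaleR
      by (intro mult_mono order_trans[OF norm_sum]) (auto simp: norm_mult intro!: sum_mono)
    finally have "norm (fejer n F x) \<le> (\<Sum>c\<in>reps M. q * norm (F M c) * \<bar>fejer_sum n (c \<oplus> x)\<bar>)"
      using n by (simp add: q_def field_simps flip: sum_divide_distrib)
    then have "sqrt (norm (fejer n F x)) \<le> sqrt (\<Sum>c\<in>reps M. q * norm (F M c) * \<bar>fejer_sum n (c \<oplus> x)\<bar>)"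
      by (rule real_sqrt_le_mono)
    also have "\<dots> \<le> (\<Sum>c\<in>reps M. sqrt (q * norm (F M c) * \<bar>fejer_sum n (c \<oplus> x)\<bar>))"
      using q by (intro sqrt_sum_le) auto
    finally show ?thesis by (simp only: real_sqrt_mult)
  qed
  then have "(\<integral>\<^sup>+x. ennreal (sqrt (norm (fejer n F x))) \<partial>haar) \<le>
      (\<integral>\<^sup>+x. ennreal (\<Sum>c\<in>reps M. sqrt q * ?f c * ?g (c \<oplus> x)) \<partial>haar)"
    by (intro nn_integral_mono ennreal_leI)
  also have "\<dots> = (\<integral>\<^sup>+x. (\<Sum>c\<in>reps M. ennreal (sqrt q * ?f c) * ennreal (?g (c \<oplus> x))) \<partial>haar)"
    using q by (intro nn_integral_cong) (simp add: ennreal_mult sum_nonneg flip: sum_ennreal)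
  also have "\<dots> = (\<Sum>c\<in>reps M. ennreal (sqrt q * ?f c) * (\<integral>\<^sup>+x. ennreal (?g (c \<oplus> x)) \<partial>haar))"
    by (subst nn_integral_sum) (auto intro!: sum.cong nn_integral_cmult)
  also have "\<dots> = (\<Sum>c\<in>reps M. ennreal (sqrt q * ?f c)) * root_int (fejer_sum n)"
    unfolding sum_distrib_right by (intro sum.cong arg_cong2[of _ _ _ _ "(*)"] refl nn_integral_gadd) measurable
  also have "(\<Sum>c\<in>reps M. ennreal (sqrt q * ?f c)) =
      ennreal (sqrt q * 2 ^ M) * (\<integral>\<^sup>+x. ennreal (?f x) \<partial>haar)"
  proof -
    have "depends_below M (\<lambda>x. ennreal (?f x))"
      by (rule depends_below_comp[OF martingale_depends_below[OF F], where g = "\<lambda>y. ennreal (sqrt (norm y))"])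
    then have "(\<integral>\<^sup>+x. ennreal (?f x) \<partial>haar) = (\<Sum>c\<in>reps M. ennreal (?f c) * ennreal (1 / 2 ^ M))"
      by (rule nn_integral_depends_below)
    moreover have "ennreal (sqrt q * 2 ^ M) * (ennreal (?f c) * ennreal (1 / 2 ^ M)) =
        ennreal (sqrt q * ?f c)" for c
      using q by (simp flip: ennreal_mult)
    ultimately show ?thesis by (simp add: sum_distrib_left)
  qed
  also have "ennreal (sqrt q * 2 ^ M) * (\<integral>\<^sup>+x. ennreal (?f x) \<partial>haar) * root_int (fejer_sum n) \<le>
      ennreal (sqrt q * 2 ^ M) * (\<integral>\<^sup>+x. ennreal (?f x) \<partial>haar) * ennreal (5 * variation n)"
    by (intro mult_left_mono root_int_fejer_sum_le) simp
  also have "\<dots> = ennreal (sqrt q * 2 ^ M * (5 * variation n)) * (\<integral>\<^sup>+x. ennreal (?f x) \<partial>haar)"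
    using q variation_ge_1[OF n(1)] by (simp add: ennreal_mult mult_ac)
  also have "\<dots> \<le> ennreal (8 * variation n) * (\<integral>\<^sup>+x. ennreal (?f x) \<partial>haar)"
  proof (intro mult_right_mono ennreal_leI)
    have "real (2 ^ M) \<le> real (2 * n)" using n(3) by (simp only: of_nat_le_iff)
    then have "q * (2 ^ M)\<^sup>2 \<le> (8 / 5)\<^sup>2"
      using n by (simp add: q_def power2_eq_square field_simps)
    then have "sqrt (q * (2 ^ M)\<^sup>2) \<le> 8 / 5" by (intro real_le_lsqrt) auto
    then have "sqrt q * 2 ^ M \<le> 8 / 5" by (simp add: real_sqrt_mult)
    then have "sqrt q * 2 ^ M * (5 * variation n) \<le> 8 / 5 * (5 * variation n)"
      using variation_ge_1[OF n(1)] by (intro mult_right_mono) auto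
    then show "sqrt q * 2 ^ M * (5 * variation n) \<le> 8 * variation n" by simp
  qed simp
  finally show ?thesis .
qed

section \<open>The maximal function along powers of two\<close>

text \<open>
  The square roots of the maximal functions up to a level are written as sums of nonnegative jumps,
  the jump \<open>l\<close> depending only on the coordinates below \<open>l\<close>. A jump is then either unaffected by a
  translation or translated by one of the finitely many unit vectors below its level.
\<close>

primrec root_max :: "(nat \<Rightarrow> walsh_group \<Rightarrow> 'a::real_normed_vector) \<Rightarrow> nat \<Rightarrow> walsh_group \<Rightarrow> real"
  where
    "root_max F 0 x = sqrt (norm (F 0 x))"
  | "root_max F (Suc m) x = max (root_max F m x) (sqrt (norm (F (Suc m) x)))"

definition root_jump :: "(nat \<Rightarrow> walsh_group \<Rightarrow> 'a::real_normed_vector) \<Rightarrow> nat \<Rightarrow> walsh_group \<Rightarrow> real"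
  where "root_jump F l x = (case l of 0 \<Rightarrow> root_max F 0 x | Suc k \<Rightarrow> root_max F (Suc k) x - root_max F k x)"

lemma root_le_root_max: "sqrt (norm (F m x)) \<le> root_max F m x"
  by (cases m) auto

lemma root_max_nonneg: "0 \<le> root_max F m x"
  by (rule order_trans[OF _ root_le_root_max]) simp

lemma root_jump_nonneg: "0 \<le> root_jump F l x"
  by (auto simp: root_jump_def root_max_nonneg split: nat.split)

lemma sum_root_jump: "(\<Sum>l\<le>m. root_jump F l x) = root_max F m x"
  by (induction m) (auto simp: root_jump_def)

lemma root_max_le: "ennreal (root_max F m x) \<le> ennpowr (max_fun F x) (1 / 2)"
proof (induction m)
  case (Suc m)
  then show ?case using root_le_max_fun[of F "Suc m" x] by (simp add: max_def)
qed (simp add: root_le_max_fun)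

lemma depends_below_root_max:
  assumes "\<And>n. depends_below n (F n)"
  shows "depends_below m (root_max F m)"
proof (induction m)
  case 0
  show ?case
    using depends_below_comp[OF assms, where g = "\<lambda>y. sqrt (norm y)" and M = 0] by simp
next
  case (Suc m)
  show ?case
    using depends_below_comp2[OF depends_below_mono[OF Suc, of "Suc m"]
        depends_below_comp[OF assms, where g = "\<lambda>y. sqrt (norm y)" and M = "Suc m"], of max] by simp
qed

lemma depends_below_root_jump:
  assumes "\<And>n. depends_below n (F n)"
  shows "depends_below l (root_jump F l)"
proof (cases l)
  case 0
  then show ?thesis
    using depends_below_root_max[OF assms, of 0] by (simp add: root_jump_def[abs_def] del: root_max.simps)
next
  case (Suc k)
  then show ?thesis
    using depends_below_comp2[OF depends_below_root_max[OF assms, of l]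
        depends_below_mono[OF depends_below_root_max[OF assms, of k], of l], of "(-)"]
    by (simp add: root_jump_def[abs_def] del: root_max.simps)
qed

lemma suminf_root_jump_le:
  "(\<Sum>l. ennreal (root_jump F l x)) \<le> ennpowr (max_fun F x) (1 / 2)"
proof (rule suminf_le_const)
  fix n
  have "(\<Sum>l<n. ennreal (root_jump F l x)) \<le> (\<Sum>l\<le>n. ennreal (root_jump F l x))"
    by (intro sum_mono2) auto
  also have "\<dots> = ennreal (root_max F n x)"
    by (simp add: sum_ennreal root_jump_nonneg sum_root_jump)
  finally show "(\<Sum>l<n. ennreal (root_jump F l x)) \<le> ennpowr (max_fun F x) (1 / 2)"
    using root_max_le order_trans by blast
qed simp

lemma root_max_le_suminf: "ennreal (root_max F m x) \<le> (\<Sum>l. ennreal (root_jump F l x))"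
proof -
  have "ennreal (root_max F m x) = (\<Sum>l\<le>m. ennreal (root_jump F l x))"
    by (simp add: sum_ennreal root_jump_nonneg sum_root_jump)
  also have "\<dots> \<le> (\<Sum>l. ennreal (root_jump F l x))"
    by (intro sum_le_suminf) auto
  finally show ?thesis .
qed

text \<open>
  The majorant of the contribution of the jump \<open>l\<close> to all dyadic Fejer means at once.
\<close>

definition shifted_jump :: "(nat \<Rightarrow> walsh_group \<Rightarrow> 'a::real_normed_vector) \<Rightarrow> nat \<Rightarrow> walsh_group \<Rightarrow> real"
  where "shifted_jump F l x = (\<Sum>s<l. sqrt (2 ^ s / 2 ^ l) * root_jump F l (unit_at s \<oplus> x))"

lemma shifted_jump_nonneg: "0 \<le> shifted_jump F l x"
  unfolding shifted_jump_def by (intro sum_nonneg mult_nonneg_nonneg root_jump_nonneg) simp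

text \<open>
  Expand the running maximum into jumps. If \<open>s \<ge> l\<close>, the translation by \<open>unit_at s\<close> does not change the
  jump \<open>l\<close>, and the weights sum to at most \<open>3\<close>. If \<open>s < l \<le> m\<close>, the weight \<open>sqrt (2 ^ s / 2 ^ m)\<close> is at
  most \<open>sqrt (2 ^ s / 2 ^ l)\<close>, in which \<open>m\<close> no longer occurs. The resulting bound is increasing in \<open>m\<close>,
  so it controls the supremum over \<open>m\<close>.
\<close>

lemma sum_shifted_root_max_le:
  assumes dep: "\<And>n. depends_below n (F n)"
  shows "(\<Sum>s<m. sqrt (2 ^ s / 2 ^ m) * root_max F m (unit_at s \<oplus> x)) \<le>
    3 * root_max F m x + (\<Sum>l\<le>m. shifted_jump F l x)"
proof -
  let ?q = "\<lambda>s l. sqrt (2 ^ s / 2 ^ l)"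
  \<comment> \<open>separates the translations that leave the jump \<open>l\<close> fixed from the others\<close>
  have pointwise: "?q s m * root_jump F l (unit_at s \<oplus> x) \<le>
      ?q s m * root_jump F l x + (if s < l then ?q s l * root_jump F l (unit_at s \<oplus> x) else 0)"
    if "l \<le> m" for s l
  proof (cases "s < l")
    case True
    have "?q s m \<le> ?q s l"
      using that by (intro real_sqrt_le_mono divide_left_mono power_increasing) auto
    then have "?q s m * root_jump F l (unit_at s \<oplus> x) \<le> ?q s l * root_jump F l (unit_at s \<oplus> x)"
      by (intro mult_right_mono root_jump_nonneg)
    moreover have "0 \<le> ?q s m * root_jump F l x"
      by (intro mult_nonneg_nonneg root_jump_nonneg) simp
    ultimately show ?thesis using True by simp
  next
    case False
    have "root_jump F l (unit_at s \<oplus> x) = root_jump F l x"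
      by (rule depends_belowD[OF depends_below_root_jump[OF dep]]) (use False in simp)
    then show ?thesis using False by simp
  qed
  have "(\<Sum>s<m. ?q s m * root_max F m (unit_at s \<oplus> x)) = (\<Sum>s<m. \<Sum>l\<le>m. ?q s m * root_jump F l (unit_at s \<oplus> x))"
    by (simp add: sum_root_jump flip: sum_distrib_left)
  also have "\<dots> \<le> (\<Sum>s<m. \<Sum>l\<le>m. ?q s m * root_jump F l x +
      (if s < l then ?q s l * root_jump F l (unit_at s \<oplus> x) else 0))"
    using pointwise by (intro sum_mono) auto
  also have "\<dots> = (\<Sum>s<m. ?q s m) * root_max F m x +
      (\<Sum>l\<le>m. \<Sum>s<m. if s < l then ?q s l * root_jump F l (unit_at s \<oplus> x) else 0)"
    by (simp only: sum.distrib sum_root_jump sum_distrib_right flip: sum_distrib_left)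
      (simp only: sum.swap[of _ "{..m}"])
  also have "(\<Sum>l\<le>m. \<Sum>s<m. if s < l then ?q s l * root_jump F l (unit_at s \<oplus> x) else 0) =
      (\<Sum>l\<le>m. shifted_jump F l x)"
    unfolding shifted_jump_def by (intro sum.cong refl sum.mono_neutral_cong_right) auto
  also have "(\<Sum>s<m. ?q s m) * root_max F m x \<le> 3 * root_max F m x"
    by (intro mult_right_mono geometric_sqrt_le root_max_nonneg)
  finally show ?thesis by linarith
qed

lemma root_fejer_pow2_le:
  fixes F :: "nat \<Rightarrow> walsh_group \<Rightarrow> 'a::{real_normed_field, banach, second_countable_topology}"
  assumes F: "martingale F"
  shows "sqrt (norm (fejer (2 ^ m) F x)) \<le> 4 * root_max F m x + (\<Sum>l\<le>m. shifted_jump F l x)"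
proof -
  have "2 ^ m * norm (fejer (2 ^ m) F x) = norm (of_nat (2 ^ m) * fejer (2 ^ m) F x)"
    by (simp add: norm_mult norm_power)
  also have "\<dots> \<le> ((2 ^ m + 1) / 2) * norm (F m x) + (\<Sum>s<m. (2 ^ s / 2) * norm (F m (unit_at s \<oplus> x)))"
    unfolding fejer_pow2[OF F]
    by (intro order_trans[OF norm_triangle_ineq] add_mono order_trans[OF norm_sum] sum_mono) auto
  also have "\<dots> \<le> 2 ^ m * norm (F m x) + (\<Sum>s<m. 2 ^ s * norm (F m (unit_at s \<oplus> x)))"
    by (intro add_mono sum_mono mult_right_mono) auto
  finally have "norm (fejer (2 ^ m) F x) \<le> norm (F m x) + (\<Sum>s<m. 2 ^ s / 2 ^ m * norm (F m (unit_at s \<oplus> x)))"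
    by (simp add: field_simps flip: sum_divide_distrib)
  then have "sqrt (norm (fejer (2 ^ m) F x)) \<le>
      sqrt (norm (F m x) + (\<Sum>s<m. 2 ^ s / 2 ^ m * norm (F m (unit_at s \<oplus> x))))"
    by (rule real_sqrt_le_mono)
  also have "\<dots> \<le> sqrt (norm (F m x)) + sqrt (\<Sum>s<m. 2 ^ s / 2 ^ m * norm (F m (unit_at s \<oplus> x)))"
    by (intro sqrt_add_le_add_sqrt sum_nonneg) auto
  also have "sqrt (\<Sum>s<m. 2 ^ s / 2 ^ m * norm (F m (unit_at s \<oplus> x))) \<le>
      (\<Sum>s<m. sqrt (2 ^ s / 2 ^ m * norm (F m (unit_at s \<oplus> x))))"
    by (intro sqrt_sum_le) auto
  also have "\<dots> \<le> (\<Sum>s<m. sqrt (2 ^ s / 2 ^ m) * root_max F m (unit_at s \<oplus> x))"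
    unfolding real_sqrt_mult by (intro sum_mono mult_left_mono root_le_root_max) simp
  also have "\<dots> \<le> 3 * root_max F m x + (\<Sum>l\<le>m. shifted_jump F l x)"
    by (rule sum_shifted_root_max_le) (rule martingale_depends_below[OF F])
  finally show ?thesis using root_le_root_max[of F m x] by linarith
qed

text \<open>
  Translations preserve the integral, and the weights form a geometric sum.
\<close>

lemma integral_shifted_jump_le:
  assumes dep: "\<And>n. depends_below n (F n)"
  shows "(\<integral>\<^sup>+x. ennreal (shifted_jump F l x) \<partial>haar) \<le> 3 * (\<integral>\<^sup>+x. ennreal (root_jump F l x) \<partial>haar)"
proof -
  have [measurable]: "root_jump F l \<in> borel_measurable haar"
    by (rule depends_below_measurable[OF depends_below_root_jump[OF dep]])
  have "(\<integral>\<^sup>+x. ennreal (shifted_jump F l x) \<partial>haar) =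
      (\<integral>\<^sup>+x. (\<Sum>s<l. ennreal (sqrt (2 ^ s / 2 ^ l)) * ennreal (root_jump F l (unit_at s \<oplus> x))) \<partial>haar)"
    unfolding shifted_jump_def
    by (intro nn_integral_cong) (simp add: ennreal_mult root_jump_nonneg flip: sum_ennreal)
  also have "\<dots> = (\<Sum>s<l. ennreal (sqrt (2 ^ s / 2 ^ l)) * (\<integral>\<^sup>+x. ennreal (root_jump F l (unit_at s \<oplus> x)) \<partial>haar))"
    by (subst nn_integral_sum) (auto intro!: sum.cong nn_integral_cmult)
  also have "\<dots> = (\<Sum>s<l. ennreal (sqrt (2 ^ s / 2 ^ l))) * (\<integral>\<^sup>+x. ennreal (root_jump F l x) \<partial>haar)"
    unfolding sum_distrib_right
    by (intro sum.cong arg_cong2[of _ _ _ _ "(*)"] refl nn_integral_gadd) measurable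
  also have "(\<Sum>s<l. ennreal (sqrt (2 ^ s / 2 ^ l))) \<le> ennreal 3"
    using ennreal_leI[OF geometric_sqrt_le[of l]] by (subst sum_ennreal) simp_all
  finally show ?thesis by (simp add: mult_right_mono)
qed

section \<open>The Hardy norm of the Fejer means\<close>

text \<open>
  For \<open>n \<le> 2 ^ m\<close> the martingale of the Fejer mean is the mean itself; for smaller \<open>m\<close> it is
  dominated by the dyadic Fejer mean and the martingale at the level \<open>m\<close>. The first kind costs
  \<open>8 * variation n\<close>; the second kind costs \<open>4 + 1\<close> running maxima and the majorant \<open>R\<close>, whose integral
  is at most \<open>3 * H\<close>. Since the variation is at least one, the total is at most \<open>16 * variation n\<close>.
\<close>

lemma integral_root_max_fun_fejer_le:
  fixes F :: "nat \<Rightarrow> walsh_group \<Rightarrow> 'a::{real_normed_field, banach, second_countable_topology}"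
  assumes F: "martingale F" and n: "1 \<le> n"
  shows "(\<integral>\<^sup>+x. ennpowr (max_fun (fun_mart (fejer n F)) x) (1 / 2) \<partial>haar) \<le>
    ennreal (16 * variation n) * (\<integral>\<^sup>+x. ennpowr (max_fun F x) (1 / 2) \<partial>haar)"
proof -
  note dep = martingale_depends_below[OF F]
  define H where "H = (\<integral>\<^sup>+x. ennpowr (max_fun F x) (1 / 2) \<partial>haar)"
  define h where "h x = (\<Sum>l. ennreal (root_jump F l x))" for x
  define R where "R x = (\<Sum>l. ennreal (shifted_jump F l x))" for x
  have [measurable]: "root_jump F l \<in> borel_measurable haar" for l
    by (rule depends_below_measurable[OF depends_below_root_jump[OF dep]])
  have [measurable]: "h \<in> borel_measurable haar" "R \<in> borel_measurable haar"
    unfolding h_def[abs_def] R_def[abs_def] shifted_jump_def by measurable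
  obtain a where a: "2 ^ a \<le> n" "n < 2 ^ Suc a"
    using ex_power_ivl1[of 2 n] n by auto
  note [measurable] = fejer_measurable
  have jumps: "ennreal (\<Sum>l\<le>m. shifted_jump F l x) \<le> R x" for m x
    unfolding R_def by (subst sum_ennreal[symmetric], rule shifted_jump_nonneg) (rule sum_le_suminf, auto)
  have H_bound: "ennreal (root_max F m x) \<le> h x" for m x
    unfolding h_def by (rule root_max_le_suminf)
  have "ennreal (sqrt (norm (fun_mart (fejer n F) m x))) \<le>
      ennreal (sqrt (norm (fejer n F x))) + (5 * h x + R x)" for m x
  proof (cases "n \<le> 2 ^ m")
    case True
    then show ?thesis by (simp add: fun_mart_fejer(1)[OF F n])
  next
    case False
    then have le: "2 ^ m \<le> n" by simp
    let ?f = "fejer (2 ^ m) F x"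
    have "real n * norm (fun_mart (fejer n F) m x) = norm (of_nat n * fun_mart (fejer n F) m x)"
      by (simp add: norm_mult)
    also have "\<dots> \<le> real (2 ^ m) * norm ?f + real (n - 2 ^ m) * norm (F m x)"
      unfolding fun_mart_fejer(2)[OF F n le]
      by (rule order_trans[OF norm_triangle_ineq]) (simp add: norm_mult norm_power del: of_nat_diff)
    also have "\<dots> \<le> real n * norm ?f + real n * norm (F m x)"
      using le by (intro add_mono mult_right_mono) (simp_all only: of_nat_le_iff diff_le_self norm_ge_zero)
    finally have "norm (fun_mart (fejer n F) m x) \<le> norm ?f + norm (F m x)"
      using n by (simp flip: distrib_left)
    then have "sqrt (norm (fun_mart (fejer n F) m x)) \<le> sqrt (norm ?f) + sqrt (norm (F m x))"
      by (intro order_trans[OF real_sqrt_le_mono sqrt_add_le_add_sqrt]) auto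
    also have "\<dots> \<le> 5 * root_max F m x + (\<Sum>l\<le>m. shifted_jump F l x)"
      using root_fejer_pow2_le[OF F, of m x] root_le_root_max[of F m x] by linarith
    finally have "ennreal (sqrt (norm (fun_mart (fejer n F) m x))) \<le>
        ennreal (5 * root_max F m x + (\<Sum>l\<le>m. shifted_jump F l x))"
      by (rule ennreal_leI)
    also have "\<dots> = 5 * ennreal (root_max F m x) + ennreal (\<Sum>l\<le>m. shifted_jump F l x)"
      by (simp add: ennreal_mult' root_max_nonneg sum_nonneg shifted_jump_nonneg)
    also have "\<dots> \<le> 5 * h x + R x"
      by (intro add_mono mult_left_mono H_bound jumps) simp
    finally show ?thesis by (rule order_trans) simp
  qed
  then have "ennpowr (max_fun (fun_mart (fejer n F)) x) (1 / 2) \<le>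
      ennreal (sqrt (norm (fejer n F x))) + (5 * h x + R x)" for x
    unfolding max_fun_def by (intro ennpowr_half_Sup_le) auto
  then have "(\<integral>\<^sup>+x. ennpowr (max_fun (fun_mart (fejer n F)) x) (1 / 2) \<partial>haar) \<le>
      (\<integral>\<^sup>+x. ennreal (sqrt (norm (fejer n F x))) + (5 * h x + R x) \<partial>haar)"
    by (intro nn_integral_mono)
  also have "\<dots> = (\<integral>\<^sup>+x. ennreal (sqrt (norm (fejer n F x))) \<partial>haar) +
      (5 * (\<integral>\<^sup>+x. h x \<partial>haar) + (\<integral>\<^sup>+x. R x \<partial>haar))"
    by (simp add: nn_integral_add nn_integral_cmult)
  also have "\<dots> \<le> ennreal (8 * variation n) * H + (5 * H + 3 * H)"
  proof (intro add_mono mult_left_mono)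
    have "(\<integral>\<^sup>+x. ennreal (sqrt (norm (F (Suc a) x))) \<partial>haar) \<le> H"
      unfolding H_def by (intro nn_integral_mono root_le_max_fun)
    then show "(\<integral>\<^sup>+x. ennreal (sqrt (norm (fejer n F x))) \<partial>haar) \<le> ennreal (8 * variation n) * H"
      using a by (intro order_trans[OF integral_root_fejer_le[OF F n, of "Suc a"]] mult_left_mono) auto
    show h: "(\<integral>\<^sup>+x. h x \<partial>haar) \<le> H"
      unfolding H_def h_def by (intro nn_integral_mono suminf_root_jump_le)
    have "(\<integral>\<^sup>+x. R x \<partial>haar) = (\<Sum>l. \<integral>\<^sup>+x. ennreal (shifted_jump F l x) \<partial>haar)"
      unfolding R_def by (rule nn_integral_suminf) (simp add: shifted_jump_def)
    also have "\<dots> \<le> (\<Sum>l. 3 * (\<integral>\<^sup>+x. ennreal (root_jump F l x) \<partial>haar))"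
      by (intro suminf_le integral_shifted_jump_le[OF dep]) auto
    also have "\<dots> = 3 * (\<integral>\<^sup>+x. h x \<partial>haar)"
      unfolding h_def by (subst nn_integral_suminf) auto
    also have "\<dots> \<le> 3 * H" using h by (intro mult_left_mono) auto
    finally show "(\<integral>\<^sup>+x. R x \<partial>haar) \<le> 3 * H" .
  qed simp
  also have "\<dots> = ennreal (8 * variation n + 8) * H"
    using variation_ge_1[OF n] by (simp add: distrib_right[symmetric])
  also have "\<dots> \<le> ennreal (16 * variation n) * H"
    using variation_ge_1[OF n] by (intro mult_right_mono ennreal_leI) auto
  finally show ?thesis unfolding H_def .
qed

lemma Hp_norm_fejer_le:
  fixes F :: "nat \<Rightarrow> walsh_group \<Rightarrow> 'a::{real_normed_field, banach, second_countable_topology}"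
  assumes F: "F \<in> Hp (1 / 2)" and n: "1 \<le> n"
  shows "Hp_norm (1 / 2) (fun_mart (fejer n F)) \<le>
    ennreal (256 * (variation n)\<^sup>2) * Hp_norm (1 / 2) F"
proof -
  define H where "H = (\<integral>\<^sup>+x. ennpowr (max_fun F x) (1 / 2) \<partial>haar)"
  have F': "martingale F" "Hp_norm (1 / 2) F < \<infinity>" using F by (auto simp: Hp_def)
  have HF: "Hp_norm (1 / 2) F = ennpowr H 2"
    by (simp add: Hp_norm_def Lp_enorm_half H_def)
  then obtain r where r: "0 \<le> r" "H = ennreal r"
    using F'(2) by (cases H) (auto simp: ennpowr_def)
  have v: "variation n \<ge> 1" by (rule variation_ge_1[OF n])
  have "Hp_norm (1 / 2) (fun_mart (fejer n F)) \<le> ennpowr (ennreal (16 * variation n) * H) 2"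
    unfolding Hp_norm_def Lp_enorm_half H_def
    by (intro ennpowr_mono integral_root_max_fun_fejer_le F' n) simp
  also have "\<dots> = ennpowr (ennreal (16 * variation n * r)) 2"
    using v r by (simp add: ennreal_mult)
  also have "\<dots> = ennreal ((16 * variation n * r)\<^sup>2)"
    using v r by (intro ennpowr_2) simp
  also have "(16 * variation n * r)\<^sup>2 = 256 * (variation n)\<^sup>2 * r\<^sup>2"
    by (simp add: power_mult_distrib)
  also have "ennreal \<dots> = ennreal (256 * (variation n)\<^sup>2) * Hp_norm (1 / 2) F"
    unfolding HF r(2) using r(1) by (subst ennpowr_2) (auto simp: ennreal_mult)
  finally show ?thesis .
qed

section \<open>A martingale with unbounded Fejer means\<close>

lemma sum_lessThan_split: "(\<Sum>j<N + m. g j) = (\<Sum>j<N. g j) + (\<Sum>i<m. g (N + i :: nat))"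
  for g :: "nat \<Rightarrow> 'b::ab_group_add"
  by (induction m) (simp_all add: add.assoc)

definition top_bit :: "nat \<Rightarrow> nat"
  where "top_bit j = (LEAST a. j < 2 ^ Suc a)"

lemma top_bit_eq: "2 ^ a \<le> j \<Longrightarrow> j < 2 ^ Suc a \<Longrightarrow> top_bit j = a"
  unfolding top_bit_def
proof (rule Least_equality)
  fix b assume "2 ^ a \<le> j" "j < 2 ^ Suc b"
  then have "(2::nat) ^ a < 2 ^ Suc b" by linarith
  then show "a \<le> b" by (simp del: power_Suc)
qed

lemma top_bit_bounds:
  assumes "1 \<le> j"
  shows "2 ^ top_bit j \<le> j" "j < 2 ^ Suc (top_bit j)"
proof -
  obtain a where a: "2 ^ a \<le> j" "j < 2 ^ Suc a"
    using ex_power_ivl1[of 2 j] assms by auto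
  then show "2 ^ top_bit j \<le> j" "j < 2 ^ Suc (top_bit j)"
    unfolding top_bit_eq[OF a] by auto
qed

text \<open>
  Coefficients that are constant, equal to \<open>lam M * 2 ^ M\<close>, on each dyadic block from \<open>2 ^ M\<close> to
  \<open>2 ^ (M + 1) - 1\<close>.
\<close>

definition block_coeff :: "(nat \<Rightarrow> real) \<Rightarrow> nat \<Rightarrow> real"
  where "block_coeff lam j = (if j = 0 then 0 else lam (top_bit j) * 2 ^ top_bit j)"

lemma block_coeff_eq: "i < 2 ^ a \<Longrightarrow> block_coeff lam (2 ^ a + i) = lam a * 2 ^ a"
  by (simp add: block_coeff_def top_bit_eq[of a])

text \<open>
  A block of equal coefficients sums to a modulated dyadic Dirichlet kernel, that is, to an atom
  supported on the cylinder of level \<open>M\<close> around the origin.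
\<close>

lemma block_sum_eq:
  "walsh_sum (block_coeff lam) (2 ^ n) x = (\<Sum>M<n. lam M * 2 ^ M * (rademacher M x * dirichlet (2 ^ M) x))"
proof (induction n)
  case 0
  then show ?case by (simp add: walsh_sum_def block_coeff_def)
next
  case (Suc n)
  have "walsh_sum (block_coeff lam) (2 ^ Suc n) x = walsh_sum (block_coeff lam) (2 ^ n) x +
      (\<Sum>i<2 ^ n. block_coeff lam (2 ^ n + i) * walsh (2 ^ n + i) x)"
    unfolding walsh_sum_def power_Suc mult_2 sum_lessThan_split by simp
  also have "(\<Sum>i<2 ^ n. block_coeff lam (2 ^ n + i) * walsh (2 ^ n + i) x) =
      (\<Sum>i<2 ^ n. lam n * 2 ^ n * (rademacher n x * walsh i x))"
    by (intro sum.cong refl) (simp add: block_coeff_eq walsh_top)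
  finally show ?case
    unfolding Suc by (simp add: dirichlet_def sum_distrib_left)
qed

definition block_martingale ::
    "(nat \<Rightarrow> real) \<Rightarrow> nat \<Rightarrow> walsh_group \<Rightarrow> 'a::{real_normed_field, banach, second_countable_topology}"
  where "block_martingale lam n = walsh_sum (\<lambda>j. of_real (block_coeff lam j)) (2 ^ n)"

lemma martingale_block_martingale: "martingale (block_martingale lam)"
  unfolding block_martingale_def[abs_def] by (rule martingale_walsh_sum)

lemma root_block_martingale_le:
  assumes lam: "\<And>M. 0 \<le> lam M"
  shows "sqrt (norm (block_martingale lam n x :: 'a::{real_normed_field, banach, second_countable_topology})) \<le>
    (\<Sum>M<n. sqrt (lam M) * 2 ^ M * indicator (cyl M (\<lambda>_. 0)) x)"
proof -
  have "(block_martingale lam n x :: 'a) = of_real (walsh_sum (block_coeff lam) (2 ^ n) x)"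
    by (simp add: block_martingale_def walsh_sum_def)
  then have "norm (block_martingale lam n x :: 'a) =
      \<bar>\<Sum>M<n. lam M * 2 ^ M * (rademacher M x * dirichlet (2 ^ M) x)\<bar>"
    unfolding block_sum_eq by (simp only: norm_of_real)
  also have "\<dots> \<le> (\<Sum>M<n. \<bar>lam M * 2 ^ M * (rademacher M x * dirichlet (2 ^ M) x)\<bar>)"
    by (rule sum_abs)
  also have "\<dots> = (\<Sum>M<n. lam M * (2 ^ M * 2 ^ M) * indicator (cyl M (\<lambda>_. 0)) x)"
    using lam by (intro sum.cong refl) (auto simp: abs_mult dirichlet_pow2 rademacher_def indicator_def mem_cyl)
  finally have "sqrt (norm (block_martingale lam n x :: 'a)) \<le>
      sqrt (\<Sum>M<n. lam M * (2 ^ M * 2 ^ M) * indicator (cyl M (\<lambda>_. 0)) x)"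
    by (rule real_sqrt_le_mono)
  also have "\<dots> \<le> (\<Sum>M<n. sqrt (lam M * (2 ^ M * 2 ^ M) * indicator (cyl M (\<lambda>_. 0)) x))"
    using lam by (intro sqrt_sum_le) simp
  also have "\<dots> = (\<Sum>M<n. sqrt (lam M) * 2 ^ M * indicator (cyl M (\<lambda>_. 0)) x)"
    by (intro sum.cong refl) (simp add: real_sqrt_mult indicator_def)
  finally show ?thesis .
qed

text \<open>
  The atom \<open>M\<close> has modulus \<open>lam M * 4 ^ M\<close> on a set of measure \<open>2 ^ (- M)\<close>, so the integral of its
  square root is \<open>sqrt (lam M)\<close>.
\<close>

lemma block_martingale_in_Hp:
  assumes lam: "\<And>M. 0 \<le> lam M" and sum: "summable (\<lambda>M. sqrt (lam M))"
  shows "(block_martingale lam :: nat \<Rightarrow> walsh_group \<Rightarrow> 'a::{real_normed_field, banach, second_countable_topology})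
    \<in> Hp (1 / 2)"
proof -
  let ?F = "block_martingale lam :: nat \<Rightarrow> walsh_group \<Rightarrow> 'a"
  let ?t = "\<lambda>M x. ennreal (sqrt (lam M) * 2 ^ M * indicator (cyl M (\<lambda>_. 0)) x)"
  have "ennreal (sqrt (norm (?F n x))) \<le> (\<Sum>M. ?t M x)" for n x
  proof -
    have "ennreal (sqrt (norm (?F n x))) \<le> (\<Sum>M<n. ?t M x)"
    proof -
      have "(\<Sum>M<n. ?t M x) = ennreal (\<Sum>M<n. sqrt (lam M) * 2 ^ M * indicator (cyl M (\<lambda>_. 0)) x)"
        by (rule sum_ennreal) (simp add: lam)
      then show ?thesis
        using ennreal_leI[OF root_block_martingale_le[where lam = lam and n = n and x = x and 'a = 'a, OF lam]]
        by (simp only:)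
    qed
    also have "\<dots> \<le> (\<Sum>M. ?t M x)" by (intro sum_le_suminf) auto
    finally show ?thesis .
  qed
  then have "ennpowr (max_fun ?F x) (1 / 2) \<le> (\<Sum>M. ?t M x)" for x
    unfolding max_fun_def by (intro ennpowr_half_Sup_le) auto
  then have "(\<integral>\<^sup>+x. ennpowr (max_fun ?F x) (1 / 2) \<partial>haar) \<le> (\<integral>\<^sup>+x. (\<Sum>M. ?t M x) \<partial>haar)"
    by (intro nn_integral_mono)
  also have "\<dots> = (\<Sum>M. \<integral>\<^sup>+x. ?t M x \<partial>haar)"
    by (rule nn_integral_suminf) measurable
  also have "\<dots> = (\<Sum>M. ennreal (sqrt (lam M)))"
  proof (intro suminf_cong)
    fix M
    show "(\<integral>\<^sup>+x. ?t M x \<partial>haar) = ennreal (sqrt (lam M))"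
      using nn_integral_indicator_le[of "sqrt (lam M) * 2 ^ M" M "\<lambda>_. 0"] lam[of M] by simp
  qed
  also have "\<dots> = ennreal (\<Sum>M. sqrt (lam M))"
    by (rule suminf_ennreal2[OF _ sum]) (simp add: lam)
  also have "\<dots> < \<infinity>" by simp
  finally have "Hp_norm (1 / 2) ?F < \<infinity>"
    unfolding Hp_norm_def Lp_enorm_half by (simp add: ennpowr_def)
  then show ?thesis
    by (simp add: Hp_def martingale_block_martingale)
qed

text \<open>
  For \<open>n = 2 ^ M + m\<close> the last block, cut at \<open>n\<close>, contributes \<open>lam M * 2 ^ M\<close> times the kernel of
  order \<open>m\<close>, up to a sign. The previous blocks are estimated by the sum of their coefficients.
\<close>

lemma norm_fejer_block_martingale_ge:
  fixes n M m :: nat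
  assumes lam: "\<And>M. 0 \<le> lam M" and n: "n = 2 ^ M + m" and m: "m < 2 ^ M"
  shows "lam M / 2 * \<bar>fejer_sum m x\<bar> \<le>
    norm (fejer n (block_martingale lam) x :: 'a::{real_normed_field, banach, second_countable_topology}) +
    (\<Sum>k<2 ^ M. \<bar>block_coeff lam k\<bar>)"
proof -
  let ?c = "block_coeff lam" and ?F = "block_martingale lam :: nat \<Rightarrow> walsh_group \<Rightarrow> 'a"
  define P where "P = (\<Sum>k<2 ^ M. real (n - k) * ?c k * walsh k x)"
  have n1: "1 \<le> n" using one_le_power[of "2::nat" M] unfolding n by linarith
  have coeff: "fourier_coeff ?F = (\<lambda>j. of_real (?c j))"
    unfolding block_martingale_def[abs_def] by (rule ext) (rule fourier_coeff_walsh_sum)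
  have fs: "fejer_sum m x = (\<Sum>i<m. real (m - i) * walsh i x)"
    using sum_walsh_sum[of "\<lambda>_. 1::real" x m] by (simp add: fejer_sum_def dirichlet_def walsh_sum_def)
  have "of_nat n * fejer n ?F x = (\<Sum>k<n. of_nat (n - k) * of_real (?c k) * of_real (walsh k x))"
    unfolding of_nat_mult_fejer[OF n1] partial_sum_eq_walsh_sum sum_walsh_sum coeff ..
  also have "\<dots> = of_real (\<Sum>k<n. real (n - k) * ?c k * walsh k x)"
    by (simp del: of_nat_diff)
  also have "(\<Sum>k<n. real (n - k) * ?c k * walsh k x) =
      P + (\<Sum>i<m. real (n - (2 ^ M + i)) * ?c (2 ^ M + i) * walsh (2 ^ M + i) x)"
    unfolding P_def by (subst n, subst sum_lessThan_split) simp
  also have "(\<Sum>i<m. real (n - (2 ^ M + i)) * ?c (2 ^ M + i) * walsh (2 ^ M + i) x) =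
      (\<Sum>i<m. lam M * 2 ^ M * rademacher M x * (real (m - i) * walsh i x))"
    using m by (intro sum.cong refl) (simp add: n block_coeff_eq walsh_top del: of_nat_diff)
  also have "\<dots> = lam M * 2 ^ M * rademacher M x * fejer_sum m x"
    by (simp only: fs sum_distrib_left)
  finally have eq: "of_nat n * fejer n ?F x = of_real (P + lam M * 2 ^ M * rademacher M x * fejer_sum m x)" .
  have "real n * norm (fejer n ?F x) = \<bar>P + lam M * 2 ^ M * rademacher M x * fejer_sum m x\<bar>"
    using arg_cong[OF eq, of norm] by (simp only: norm_mult norm_of_nat norm_of_real)
  moreover have "\<bar>lam M * 2 ^ M * rademacher M x * fejer_sum m x\<bar> = lam M * 2 ^ M * \<bar>fejer_sum m x\<bar>"
    using lam[of M] by (simp add: abs_mult rademacher_def)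
  moreover have "\<bar>P\<bar> \<le> real n * (\<Sum>k<2 ^ M. \<bar>?c k\<bar>)"
    unfolding P_def sum_distrib_left
    by (intro order_trans[OF sum_abs] sum_mono) (simp add: abs_mult mult_right_mono)
  ultimately have "lam M * 2 ^ M * \<bar>fejer_sum m x\<bar> \<le>
      real n * (norm (fejer n ?F x) + (\<Sum>k<2 ^ M. \<bar>?c k\<bar>))"
    by (simp only: distrib_left)
  moreover have "real n * (lam M / 2 * \<bar>fejer_sum m x\<bar>) \<le> lam M * 2 ^ M * \<bar>fejer_sum m x\<bar>"
  proof -
    have "n \<le> 2 * 2 ^ M" using n m by simp
    then have "real n \<le> real (2 * 2 ^ M)" by (simp only: of_nat_le_iff)
    then have "real n * (lam M / 2 * \<bar>fejer_sum m x\<bar>) \<le> 2 * 2 ^ M * (lam M / 2 * \<bar>fejer_sum m x\<bar>)"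
      using lam[of M] by (intro mult_right_mono) auto
    then show ?thesis by (simp add: mult_ac)
  qed
  ultimately have "real n * (lam M / 2 * \<bar>fejer_sum m x\<bar>) \<le>
      real n * (norm (fejer n ?F x) + (\<Sum>k<2 ^ M. \<bar>?c k\<bar>))"
    by linarith
  then show ?thesis using n1 by simp
qed

text \<open>
  Passing from \<open>n\<close> to \<open>m = n - 2 ^ M\<close> loses at most one rise, and \<open>variation n \<le> 2 * card (rises n) + 2\<close>:
  together these account for the constant \<open>4\<close>.
\<close>

lemma integral_root_fejer_block_martingale_ge:
  fixes n M :: nat
  assumes lam: "\<And>M. 0 \<le> lam M" and n: "2 ^ M \<le> n" "n < 2 ^ Suc M"
    and Q: "(\<Sum>k<2 ^ M. \<bar>block_coeff lam k\<bar>) \<le> Q\<^sup>2" "0 \<le> Q"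
  shows "ennreal (sqrt (lam M) * (variation n - 4) / 16 - Q) \<le>
    (\<integral>\<^sup>+x. ennreal (sqrt (norm (fejer n (block_martingale lam) x
      :: 'a::{real_normed_field, banach, second_countable_topology}))) \<partial>haar)"
proof -
  let ?F = "block_martingale lam :: nat \<Rightarrow> walsh_group \<Rightarrow> 'a"
  let ?I = "\<integral>\<^sup>+x. ennreal (sqrt (norm (fejer n ?F x))) \<partial>haar"
  note [measurable] = fejer_measurable
  define m where "m = n - 2 ^ M"
  have m: "n = 2 ^ M + m" "m < 2 ^ M" using n by (auto simp: m_def)
  have pt: "sqrt (lam M / 2) * sqrt \<bar>fejer_sum m x\<bar> \<le> sqrt (norm (fejer n ?F x)) + Q" for x
  proof -
    have "sqrt (lam M / 2 * \<bar>fejer_sum m x\<bar>) \<le> sqrt (norm (fejer n ?F x) + Q\<^sup>2)"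
      using norm_fejer_block_martingale_ge[where lam = lam and x = x and 'a = 'a, OF lam m] Q(1)
      by (intro real_sqrt_le_mono) linarith
    also have "\<dots> \<le> sqrt (norm (fejer n ?F x)) + sqrt (Q\<^sup>2)"
      by (rule sqrt_add_le_add_sqrt) auto
    finally show ?thesis using Q(2) by (simp flip: real_sqrt_mult)
  qed
  have "sqrt (lam M) * (variation n - 4) / 16 \<le> sqrt (lam M / 2) * (card (rises m) / (4 * sqrt 2))"
  proof -
    have "variation n - 4 \<le> 2 * real (card (rises m))"
      using variation_le_rises[of n] card_rises_top[OF m(2)] unfolding m(1) by linarith
    then have "sqrt (lam M) * (variation n - 4) / 16 \<le> sqrt (lam M) * (2 * real (card (rises m))) / 16"
      using lam by (intro divide_right_mono mult_left_mono) auto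
    also have "\<dots> = sqrt (lam M / 2) * (card (rises m) / (4 * sqrt 2))"
      by (simp add: real_sqrt_divide field_simps)
    finally show ?thesis .
  qed
  then have "ennreal (sqrt (lam M) * (variation n - 4) / 16) \<le>
      ennreal (sqrt (lam M / 2)) * ennreal (card (rises m) / (4 * sqrt 2))"
    using lam[of M] by (simp add: ennreal_leI flip: ennreal_mult)
  also have "\<dots> \<le> ennreal (sqrt (lam M / 2)) * root_int (fejer_sum m)"
    by (intro mult_left_mono root_int_fejer_sum_ge) simp
  also have "\<dots> = (\<integral>\<^sup>+x. ennreal (sqrt (lam M / 2) * sqrt \<bar>fejer_sum m x\<bar>) \<partial>haar)"
    using lam[of M] by (simp add: ennreal_mult nn_integral_cmult)
  also have "\<dots> \<le> (\<integral>\<^sup>+x. ennreal (sqrt (norm (fejer n ?F x))) + ennreal Q \<partial>haar)"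
    using ennreal_leI[OF pt] Q(2) by (intro nn_integral_mono) simp
  also have "\<dots> = ?I + ennreal Q"
    using prob_space.emeasure_space_1[OF prob_space_haar] by (simp add: nn_integral_add)
  finally have le: "ennreal (sqrt (lam M) * (variation n - 4) / 16) \<le> ?I + ennreal Q" .
  show ?thesis
  proof (cases ?I)
    case (real r)
    then have "ennreal (sqrt (lam M) * (variation n - 4) / 16) \<le> ennreal (r + Q)"
      using le Q(2) by simp
    then have "sqrt (lam M) * (variation n - 4) / 16 \<le> r + Q"
      using real(1) Q(2) by (subst (asm) ennreal_le_iff) auto
    then show ?thesis unfolding real(2) by (intro ennreal_leI) simp
  qed simp
qed

lemma Lp_norm_half_divide_ge:
  fixes f :: "walsh_group \<Rightarrow> 'a::{real_normed_field, banach, second_countable_topology}"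
  assumes [measurable]: "f \<in> borel_measurable haar" and \<phi>: "0 < \<phi>" and k: "0 \<le> k"
    and le: "ennreal (k * sqrt \<phi>) \<le> (\<integral>\<^sup>+x. ennreal (sqrt (norm (f x))) \<partial>haar)"
  shows "ennreal (k\<^sup>2) \<le> Lp_norm (1 / 2) (\<lambda>x. f x / of_real \<phi>)"
proof -
  have "ennreal k = ennreal (1 / sqrt \<phi>) * ennreal (k * sqrt \<phi>)"
    using \<phi> k by (simp flip: ennreal_mult)
  also have "\<dots> \<le> ennreal (1 / sqrt \<phi>) * (\<integral>\<^sup>+x. ennreal (sqrt (norm (f x))) \<partial>haar)"
    by (intro mult_left_mono le) simp
  also have "\<dots> = (\<integral>\<^sup>+x. ennreal (1 / sqrt \<phi>) * ennreal (sqrt (norm (f x))) \<partial>haar)"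
    by (rule nn_integral_cmult[symmetric]) simp
  also have "\<dots> = (\<integral>\<^sup>+x. ennpowr (ennreal (norm (f x / of_real \<phi>))) (1 / 2) \<partial>haar)"
    using \<phi> by (intro nn_integral_cong, subst ennpowr_half)
      (auto simp: norm_divide real_sqrt_divide simp flip: ennreal_mult)
  finally have "ennpowr (ennreal k) 2 \<le> Lp_norm (1 / 2) (\<lambda>x. f x / of_real \<phi>)"
    unfolding Lp_norm_def Lp_enorm_half by (intro ennpowr_mono) auto
  then show ?thesis using k by (simp add: ennpowr_2)
qed

text \<open>
  A term of the subsequence with large ratio exists arbitrarily far out, where the terms exceed
  \<open>2 ^ (p + 1)\<close>.
\<close>

lemma exists_large_variation:
  assumes mono: "strict_mono nk" and pos: "\<And>k. 1 \<le> nk k" and \<Phi>: "\<And>n. 1 \<le> n \<Longrightarrow> 1 \<le> \<Phi> n"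
    and lim: "limsup (\<lambda>k. ereal ((variation (nk k))\<^sup>2 / \<Phi> (nk k))) = \<infinity>"
  shows "\<exists>k. p < top_bit (nk k) \<and> R * sqrt (\<Phi> (nk k)) \<le> variation (nk k)"
proof -
  have "\<exists>k\<ge>2 ^ Suc p. R\<^sup>2 \<le> (variation (nk k))\<^sup>2 / \<Phi> (nk k)"
  proof (rule ccontr)
    assume "\<not> ?thesis"
    then have "\<forall>k\<ge>2 ^ Suc p. ereal ((variation (nk k))\<^sup>2 / \<Phi> (nk k)) \<le> ereal (R\<^sup>2)"
      by (auto intro: less_imp_le)
    then have "eventually (\<lambda>k. ereal ((variation (nk k))\<^sup>2 / \<Phi> (nk k)) \<le> ereal (R\<^sup>2)) sequentially"
      unfolding eventually_sequentially by blast
    then have "limsup (\<lambda>k. ereal ((variation (nk k))\<^sup>2 / \<Phi> (nk k))) \<le> ereal (R\<^sup>2)"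
      by (rule Limsup_bounded)
    then show False using lim by simp
  qed
  then obtain k where k: "2 ^ Suc p \<le> k" "R\<^sup>2 \<le> (variation (nk k))\<^sup>2 / \<Phi> (nk k)" by blast
  have \<Phi>k: "1 \<le> \<Phi> (nk k)" using \<Phi> pos by blast
  have "(2::nat) ^ Suc p < 2 ^ Suc (top_bit (nk k))"
    using k(1) seq_suble[OF mono, of k] top_bit_bounds(2)[OF pos, of k] by linarith
  then have "p < top_bit (nk k)" by (simp del: power_Suc)
  moreover have "R * sqrt (\<Phi> (nk k)) \<le> variation (nk k)"
  proof (rule power2_le_imp_le)
    show "(R * sqrt (\<Phi> (nk k)))\<^sup>2 \<le> (variation (nk k))\<^sup>2"
      using k(2) \<Phi>k by (simp add: power_mult_distrib field_simps)
    show "0 \<le> variation (nk k)" using variation_ge_1[OF pos, of k] by linarith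
  qed
  ultimately show ?thesis by blast
qed

text \<open>
  The weight at \<open>\<tau> k\<close> is \<open>4 ^ (- k)\<close>, and the blocks outside the range of \<open>\<tau>\<close> vanish.
\<close>

definition lacunary_weight :: "(nat \<Rightarrow> nat) \<Rightarrow> nat \<Rightarrow> real"
  where "lacunary_weight \<tau> M = (if M \<in> range \<tau> then (1 / 4) ^ inv \<tau> M else 0)"

lemma lacunary_weight:
  assumes \<tau>: "strict_mono \<tau>"
  shows lacunary_weight_nonneg: "0 \<le> lacunary_weight \<tau> M"
    and lacunary_weight_le_1: "lacunary_weight \<tau> M \<le> 1"
    and sqrt_lacunary_weight: "sqrt (lacunary_weight \<tau> (\<tau> k)) = (1 / 2) ^ k"
    and summable_sqrt_lacunary_weight: "summable (\<lambda>M. sqrt (lacunary_weight \<tau> M))"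
proof -
  show "0 \<le> lacunary_weight \<tau> M" "lacunary_weight \<tau> M \<le> 1"
    by (auto simp: lacunary_weight_def power_le_one)
  show root: "sqrt (lacunary_weight \<tau> (\<tau> k)) = (1 / 2) ^ k" for k
    using strict_mono_imp_inj_on[OF \<tau>] by (simp add: lacunary_weight_def real_sqrt_power real_sqrt_divide)
  have "summable (\<lambda>k. sqrt (lacunary_weight \<tau> (\<tau> k)))"
    unfolding root by (rule summable_geometric) simp
  then show "summable (\<lambda>M. sqrt (lacunary_weight \<tau> M))"
    by (subst (asm) summable_mono_reindex[OF \<tau>]) (auto simp: lacunary_weight_def)
qed

text \<open>
  There is no block strictly between \<open>\<tau> k\<close> and \<open>\<tau> (k + 1)\<close>, so the coefficients below
  \<open>2 ^ \<tau> (k + 1)\<close> live below \<open>2 ^ (\<tau> k + 1)\<close>, where they are at most \<open>2 ^ \<tau> k\<close>. The bound thus depends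
  only on what was chosen before the step \<open>k + 1\<close>.
\<close>

lemma sum_block_coeff_lacunary_le:
  assumes \<tau>: "strict_mono \<tau>"
  shows "(\<Sum>j<2 ^ \<tau> (Suc k). \<bar>block_coeff (lacunary_weight \<tau>) j\<bar>) \<le> (2 ^ Suc (\<tau> k))\<^sup>2"
proof -
  let ?c = "block_coeff (lacunary_weight \<tau>)" and ?p = "\<tau> k"
  have coeff: "\<bar>?c j\<bar> \<le> (if j < 2 ^ Suc ?p then 2 ^ ?p else 0)" if j: "j < 2 ^ \<tau> (Suc k)" for j
  proof (cases "j = 0")
    case False
    then have b: "2 ^ top_bit j \<le> j" "j < 2 ^ Suc (top_bit j)" using top_bit_bounds[of j] by auto
    show ?thesis
    proof (cases "j < 2 ^ Suc ?p")
      case True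
      have "(2::nat) ^ top_bit j < 2 ^ Suc ?p" using b(1) True by linarith
      then have "top_bit j \<le> ?p" by (simp del: power_Suc)
      then have "(2::real) ^ top_bit j \<le> 2 ^ ?p" by (intro power_increasing) auto
      then have "lacunary_weight \<tau> (top_bit j) * 2 ^ top_bit j \<le> 1 * 2 ^ ?p"
        by (intro mult_mono lacunary_weight_le_1[OF \<tau>]) auto
      then show ?thesis
        using True False lacunary_weight_nonneg[OF \<tau>] by (simp add: block_coeff_def abs_mult)
    next
      case outside: False
      have "(2::nat) ^ Suc ?p < 2 ^ Suc (top_bit j)" "(2::nat) ^ top_bit j < 2 ^ \<tau> (Suc k)"
        using b outside j by linarith+
      then have gap: "\<tau> k < top_bit j" "top_bit j < \<tau> (Suc k)" by (simp_all del: power_Suc)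
      have "top_bit j \<notin> range \<tau>"
      proof
        assume "top_bit j \<in> range \<tau>"
        then obtain i where "top_bit j = \<tau> i" by blast
        then have "k < i" "i < Suc k" using gap strict_mono_less[OF \<tau>] by simp_all
        then show False by simp
      qed
      then show ?thesis using outside by (simp add: block_coeff_def lacunary_weight_def)
    qed
  qed (simp add: block_coeff_def)
  have "(\<Sum>j<2 ^ \<tau> (Suc k). \<bar>?c j\<bar>) \<le> (\<Sum>j<2 ^ \<tau> (Suc k). if j < (2::nat) ^ Suc ?p then 2 ^ ?p else 0)"
    using coeff by (intro sum_mono) auto
  also have "\<dots> = (\<Sum>j<(2::nat) ^ Suc ?p. 2 ^ ?p)"
  proof (rule sum.mono_neutral_cong_right)
    have "(2::nat) ^ Suc ?p \<le> 2 ^ \<tau> (Suc k)"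
      using strict_monoD[OF \<tau>, of k "Suc k"] by (intro power_increasing) auto
    then show "{..<(2::nat) ^ Suc ?p} \<subseteq> {..<2 ^ \<tau> (Suc k)}" by auto
  qed auto
  also have "\<dots> \<le> (2 ^ Suc ?p)\<^sup>2"
    by (simp add: power2_eq_square)
  finally show ?thesis .
qed

text \<open>
  A gliding hump. The indices \<open>\<alpha> k\<close> are chosen recursively such that the variation of the next term
  outweighs, relative to the square root of \<open>\<Phi>\<close>, both the small weight \<open>4 ^ (- k)\<close> of its block and
  the error \<open>2 ^ (\<tau> k + 1)\<close> caused by the blocks already chosen.
\<close>

lemma exists_unbounded_fejer_means:
  assumes mono: "strict_mono nk" and pos: "\<And>k. 1 \<le> nk k" and \<Phi>: "\<And>n. 1 \<le> n \<Longrightarrow> 1 \<le> \<Phi> n"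
    and lim: "limsup (\<lambda>k. ereal ((variation (nk k))\<^sup>2 / \<Phi> (nk k))) = \<infinity>"
  shows "\<exists>F :: nat \<Rightarrow> walsh_group \<Rightarrow> 'a::{real_normed_field, banach, second_countable_topology}.
    F \<in> Hp (1 / 2) \<and>
    (SUP k. Lp_norm (1 / 2) (\<lambda>x. fejer (nk k) F x / of_real (\<Phi> (nk k)))) = \<infinity>"
proof -
  \<comment> \<open>the factor required of the index that follows an index with leading digit at \<open>p\<close>\<close>
  let ?R = "\<lambda>k p. 16 * 2 ^ Suc k * (real (Suc k) + 2 ^ Suc p) + 4 :: real"
  have "\<exists>\<alpha>. \<forall>k. True \<and> (top_bit (nk (\<alpha> k)) < top_bit (nk (\<alpha> (Suc k))) \<and>
      ?R k (top_bit (nk (\<alpha> k))) * sqrt (\<Phi> (nk (\<alpha> (Suc k)))) \<le> variation (nk (\<alpha> (Suc k))))"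
    by (rule dependent_nat_choice) (use exists_large_variation[OF mono pos \<Phi> lim] in auto)
  then obtain \<alpha> where \<alpha>: "\<And>k. top_bit (nk (\<alpha> k)) < top_bit (nk (\<alpha> (Suc k)))"
    "\<And>k. ?R k (top_bit (nk (\<alpha> k))) * sqrt (\<Phi> (nk (\<alpha> (Suc k)))) \<le> variation (nk (\<alpha> (Suc k)))"
    by blast
  define \<tau> where "\<tau> k = top_bit (nk (\<alpha> k))" for k
  have \<tau>: "strict_mono \<tau>" unfolding strict_mono_Suc_iff \<tau>_def using \<alpha>(1) by blast
  define F :: "nat \<Rightarrow> walsh_group \<Rightarrow> 'a" where "F = block_martingale (lacunary_weight \<tau>)"
  have large: "ennreal ((real (Suc k))\<^sup>2) \<le>
      Lp_norm (1 / 2) (\<lambda>x. fejer (nk (\<alpha> (Suc k))) F x / of_real (\<Phi> (nk (\<alpha> (Suc k)))))" for k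
  proof (rule Lp_norm_half_divide_ge[OF fejer_measurable])
    define n where "n = nk (\<alpha> (Suc k))"
    have \<Phi>n: "1 \<le> \<Phi> n" unfolding n_def by (intro \<Phi> pos)
    then show "0 < \<Phi> (nk (\<alpha> (Suc k)))" unfolding n_def by linarith
    let ?s = "sqrt (\<Phi> n)" and ?Q = "2 ^ Suc (\<tau> k) :: real"
    have s: "1 \<le> ?s" using \<Phi>n by simp
    have n: "2 ^ \<tau> (Suc k) \<le> n" "n < 2 ^ Suc (\<tau> (Suc k))"
      unfolding n_def \<tau>_def by (intro top_bit_bounds pos)+
    have "real (Suc k) * ?s \<le> (1 / 2) ^ Suc k * (variation n - 4) / 16 - ?Q"
    proof -
      have "16 * 2 ^ Suc k * (real (Suc k) + ?Q) * ?s + 4 * 1 \<le> ?R k (\<tau> k) * ?s"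
        using s by (simp add: distrib_right del: power_Suc of_nat_Suc)
      also have "\<dots> \<le> variation n"
        using \<alpha>(2)[of k] by (simp only: n_def \<tau>_def)
      finally have "16 * 2 ^ Suc k * (real (Suc k) + ?Q) * ?s \<le> variation n - 4" by simp
      then have "(1 / 2) ^ Suc k * (16 * 2 ^ Suc k * (real (Suc k) + ?Q) * ?s) / 16 \<le>
          (1 / 2) ^ Suc k * (variation n - 4) / 16"
        by (intro divide_right_mono mult_left_mono) auto
      also have "(1 / 2) ^ Suc k * (16 * 2 ^ Suc k * (real (Suc k) + ?Q) * ?s) / 16 = (real (Suc k) + ?Q) * ?s"
        by (simp add: power_one_over)
      finally have "real (Suc k) * ?s + ?Q * ?s \<le> (1 / 2) ^ Suc k * (variation n - 4) / 16"
        by (simp only: distrib_right)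
      moreover have "?Q * 1 \<le> ?Q * ?s" using s by (intro mult_left_mono) auto
      ultimately show ?thesis by linarith
    qed
    then have "ennreal (real (Suc k) * ?s) \<le> ennreal ((1 / 2) ^ Suc k * (variation n - 4) / 16 - ?Q)"
      by (rule ennreal_leI)
    also have "\<dots> \<le> (\<integral>\<^sup>+x. ennreal (sqrt (norm (fejer n F x))) \<partial>haar)"
      using integral_root_fejer_block_martingale_ge[OF lacunary_weight_nonneg[OF \<tau>] n
          sum_block_coeff_lacunary_le[OF \<tau>], where 'a = 'a]
      unfolding sqrt_lacunary_weight[OF \<tau>] F_def by simp
    finally show "ennreal (real (Suc k) * sqrt (\<Phi> (nk (\<alpha> (Suc k))))) \<le>
        (\<integral>\<^sup>+x. ennreal (sqrt (norm (fejer (nk (\<alpha> (Suc k))) F x))) \<partial>haar)"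
      unfolding n_def .
  qed simp
  have "(SUP k. Lp_norm (1 / 2) (\<lambda>x. fejer (nk k) F x / of_real (\<Phi> (nk k)))) = \<infinity>" (is "?S = _")
  proof (rule ccontr)
    assume "?S \<noteq> \<infinity>"
    then obtain r where r: "0 \<le> r" "?S = ennreal r" by (cases ?S) auto
    obtain k where k: "r < real k" using reals_Archimedean2 by blast
    have "ennreal ((real (Suc k))\<^sup>2) \<le> ?S"
      by (rule order_trans[OF large]) (rule SUP_upper, simp)
    then have "(real (Suc k))\<^sup>2 \<le> r" unfolding r(2) using r(1) by (subst (asm) ennreal_le_iff) auto
    moreover have "real (Suc k) * 1 \<le> (real (Suc k))\<^sup>2"
      unfolding power2_eq_square by (intro mult_left_mono) auto
    ultimately show False using k by simp
  qed
  moreover have "F \<in> Hp (1 / 2)"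
    unfolding F_def
    by (intro block_martingale_in_Hp lacunary_weight_nonneg[OF \<tau>] summable_sqrt_lacunary_weight[OF \<tau>])
  ultimately show ?thesis by blast
qed

theorem theorem1:
  shows
    "(\<exists>c::real. c > 0 \<and>
        (\<forall>F :: nat \<Rightarrow> walsh_group \<Rightarrow> 'a::{real_normed_field, banach, second_countable_topology}.
          F \<in> Hp (1/2) \<longrightarrow>
          (\<forall>n\<ge>1. Hp_norm (1/2) (fun_mart (fejer n F))
                  \<le> ennreal (c * (variation n)\<^sup>2) * Hp_norm (1/2) F)))
     \<and>
     (\<forall>(nk :: nat \<Rightarrow> nat) (\<Phi> :: nat \<Rightarrow> real).
        strict_mono nk \<and> (\<forall>k. nk k \<ge> 1) \<and>
        (SUP k. ereal (variation (nk k))) = \<infinity> \<and>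
        (\<forall>n\<ge>1. \<Phi> n \<ge> 1) \<and> mono_on {1..} \<Phi> \<and>
        filterlim \<Phi> at_top sequentially \<and>
        limsup (\<lambda>k. ereal ((variation (nk k))\<^sup>2 / \<Phi> (nk k))) = \<infinity>
        \<longrightarrow>
        (\<exists>F :: nat \<Rightarrow> walsh_group \<Rightarrow> 'a.
          F \<in> Hp (1/2) \<and>
          (SUP k. Lp_norm (1/2) (\<lambda>x. fejer (nk k) F x / of_real (\<Phi> (nk k)))) = \<infinity>))"
proof (rule conjI)
  show "\<exists>c::real. c > 0 \<and>
      (\<forall>F :: nat \<Rightarrow> walsh_group \<Rightarrow> 'a. F \<in> Hp (1/2) \<longrightarrow>
        (\<forall>n\<ge>1. Hp_norm (1/2) (fun_mart (fejer n F)) \<le> ennreal (c * (variation n)\<^sup>2) * Hp_norm (1/2) F))"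
  proof (intro exI[of _ 256] conjI allI impI)
    fix F :: "nat \<Rightarrow> walsh_group \<Rightarrow> 'a" and n :: nat
    assume "F \<in> Hp (1/2)" "1 \<le> n"
    then show "Hp_norm (1/2) (fun_mart (fejer n F)) \<le> ennreal (256 * (variation n)\<^sup>2) * Hp_norm (1/2) F"
      by (rule Hp_norm_fejer_le)
  qed simp
qed (intro allI impI exists_unbounded_fejer_means, (elim conjE, blast)+)

end
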